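(* Let $\Delta=2^\ell$. For every pair of nonnegative measures $\mu,\nu$ on $[\Delta]^d$ and every $s\in\mathbb{Z}^d$, \[\|\mu-\nu\|_{\mathrm{EMD}}\le O(\sqrt{d})\cdot\|G_s(\mu-\nu)\|_1.\] In addition, if $\mu$ and $\nu$ are probability measures over $[\Delta]^d$ and $\mu$ has support of size at most $k$, then for $s$ chosen uniformly at random from $[\Delta]^d$, \[\Pr\left[\|G_s(\mu-\nu)\|_1\le O(d)\cdot O(\log k+\log\log\Delta)\cdot\|\mu-\nu\|_{\mathrm{EMD}}\right]\ge0.999.\]
   Context: For $s\in\mathbb{Z}^d$ and $t\in\{0,\ldots,\ell\}$, $\mathcal{G}_{s,t}$ is the grid on $\mathbb{Z}^d$ of half-open axis-parallel hypercube cells of side length $2^t$, positioned so that $s$ is a corner of a cell; for $\mu\in\mathbb{R}^{[\Delta]^d}$, $G_{s,t}\mu$ is the vector indexed by the cells of $\mathcal{G}_{s,t}$ giving the total mass of $\mu$ in each cell, and $G_s\mu=(G_{s,0}\mu)\circ(2G_{s,1}\mu)\circ\cdots\circ(2^tG_{s,t}\mu)\circ\cdots\circ(2^\ell G_{s,\ell}\mu)$ (concatenation). For nonnegative $x,y\in\mathbb{R}^{[\Delta]^d}$ with $\|x\|_1=\|y\|_1$, $\mathrm{EMD}(x,y)=\min_f\sum_{i,j}f(i,j)\|i-j\|_2$ over nonnegative $f$ with row sums $x$ and column sums $y$; for general nonnegative $x,y$, $\mathrm{EMD}(x,y)=\inf\{\mathrm{EMD}(x',y')+d\Delta(\|x-x'\|_1+\|y-y'\|_1)\}$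 over $0\le x'\le x$, $0\le y'\le y$ with $\|x'\|_1=\|y'\|_1$. For a vector $v$, $v^+=\frac{|v|+v}{2}$, $v^-=v^+-v$, and $\|v\|_{\mathrm{EMD}}=\mathrm{EMD}(v^+,v^-)$.
   Formalization: The first bound is shown as stated for μ, ν of equal total mass; for unequal masses, where it is false (unit mass against 0), the term dΔ·|‖μ‖₁−‖ν‖₁| is added. The factor log k + loglog Δ is replaced by its maximum with 1, which matters only for k=1, Δ=2 or Δ=1. *)

theory Defs
  imports "HOL-Probability.Probability"
begin

text \<open>Points of \<open>\<int>\<^sup>d\<close> are functions \<^typ>\<open>nat \<Rightarrow> int\<close> that are \<^term>\<open>undefined\<close> outside the
  coordinates \<open>0, \<dots>, d - 1\<close>, so that constants can be chosen uniformly in the dimension.  The set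
  \<open>[\<Delta>]\<close> is \<open>{1, \<dots>, \<Delta>}\<close>.\<close>

definition lattice :: "nat \<Rightarrow> (nat \<Rightarrow> int) set" where
  "lattice d = {..<d} \<rightarrow>\<^sub>E UNIV"

definition cube :: "nat \<Rightarrow> nat \<Rightarrow> (nat \<Rightarrow> int) set" where
  "cube d \<Delta> = {..<d} \<rightarrow>\<^sub>E {1..int \<Delta>}"

definition dist2 :: "nat \<Rightarrow> (nat \<Rightarrow> int) \<Rightarrow> (nat \<Rightarrow> int) \<Rightarrow> real" where
  "dist2 d p q = L2_set (\<lambda>m. real_of_int (p m - q m)) {..<d}"

definition l1_norm :: "'a set \<Rightarrow> ('a \<Rightarrow> real) \<Rightarrow> real" where
  "l1_norm I v = (\<Sum>\<^sub>\<infinity>i\<in>I. \<bar>v i\<bar>)"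

text \<open>A vector in \<open>\<real>\<close> to the power \<open>[\<Delta>]\<^sup>d\<close> is a function on points of which only the values on
  \<^term>\<open>cube d \<Delta>\<close> matter.\<close>

definition nonneg_on :: "'a set \<Rightarrow> ('a \<Rightarrow> real) \<Rightarrow> bool" where
  "nonneg_on I v \<longleftrightarrow> (\<forall>i\<in>I. 0 \<le> v i)"

definition prob_on :: "'a set \<Rightarrow> ('a \<Rightarrow> real) \<Rightarrow> bool" where
  "prob_on I v \<longleftrightarrow> nonneg_on I v \<and> sum v I = 1"

definition supp_on :: "'a set \<Rightarrow> ('a \<Rightarrow> real) \<Rightarrow> 'a set" where
  "supp_on I v = {i \<in> I. v i \<noteq> 0}"


definition couplings ::
  "nat \<Rightarrow> nat \<Rightarrow> ((nat \<Rightarrow> int) \<Rightarrow> real) \<Rightarrow> ((nat \<Rightarrow> int) \<Rightarrow> real)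
    \<Rightarrow> ((nat \<Rightarrow> int) \<Rightarrow> (nat \<Rightarrow> int) \<Rightarrow> real) set" where
  "couplings d \<Delta> x y =
    {f. (\<forall>i\<in>cube d \<Delta>. \<forall>j\<in>cube d \<Delta>. 0 \<le> f i j)
      \<and> (\<forall>i\<in>cube d \<Delta>. (\<Sum>j\<in>cube d \<Delta>. f i j) = x i)
      \<and> (\<forall>j\<in>cube d \<Delta>. (\<Sum>i\<in>cube d \<Delta>. f i j) = y j)}"

text \<open>For nonnegative \<open>x\<close> and \<open>y\<close> of equal mass the set of couplings is nonempty and compact in its
  finitely many relevant entries, so the infimum is a minimum.\<close>

definition emd_balanced ::
  "nat \<Rightarrow> nat \<Rightarrow> ((nat \<Rightarrow> int) \<Rightarrow> real) \<Rightarrow> ((nat \<Rightarrow> int) \<Rightarrow> real) \<Rightarrow> real" where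
  "emd_balanced d \<Delta> x y =
    (INF f\<in>couplings d \<Delta> x y. \<Sum>i\<in>cube d \<Delta>. \<Sum>j\<in>cube d \<Delta>. f i j * dist2 d i j)"

definition emd ::
  "nat \<Rightarrow> nat \<Rightarrow> ((nat \<Rightarrow> int) \<Rightarrow> real) \<Rightarrow> ((nat \<Rightarrow> int) \<Rightarrow> real) \<Rightarrow> real" where
  "emd d \<Delta> x y =
    (if l1_norm (cube d \<Delta>) x = l1_norm (cube d \<Delta>) y then emd_balanced d \<Delta> x y
     else Inf {emd_balanced d \<Delta> x' y'
            + real d * real \<Delta> * (l1_norm (cube d \<Delta>) (x - x') + l1_norm (cube d \<Delta>) (y - y')) | x' y'.
          (\<forall>i\<in>cube d \<Delta>. 0 \<le> x' i \<and> x' i \<le> x i) \<and>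
          (\<forall>i\<in>cube d \<Delta>. 0 \<le> y' i \<and> y' i \<le> y i) \<and>
          l1_norm (cube d \<Delta>) x' = l1_norm (cube d \<Delta>) y'})"

definition pos_part :: "('a \<Rightarrow> real) \<Rightarrow> 'a \<Rightarrow> real" where
  "pos_part v = (\<lambda>i. (\<bar>v i\<bar> + v i) / 2)"

definition neg_part :: "('a \<Rightarrow> real) \<Rightarrow> 'a \<Rightarrow> real" where
  "neg_part v = pos_part v - v"

definition emd_norm :: "nat \<Rightarrow> nat \<Rightarrow> ((nat \<Rightarrow> int) \<Rightarrow> real) \<Rightarrow> real" where
  "emd_norm d \<Delta> v = emd d \<Delta> (pos_part v) (neg_part v)"


text \<open>Cells are taken as sets of lattice points; \<open>s\<close> is the least corner of the cell \<open>c = 0\<close>.\<close>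

definition cell :: "nat \<Rightarrow> (nat \<Rightarrow> int) \<Rightarrow> nat \<Rightarrow> (nat \<Rightarrow> int) \<Rightarrow> (nat \<Rightarrow> int) set" where
  "cell d s t c = {p \<in> lattice d. \<forall>m<d. s m + 2 ^ t * c m \<le> p m \<and> p m < s m + 2 ^ t * (c m + 1)}"

definition grid :: "nat \<Rightarrow> (nat \<Rightarrow> int) \<Rightarrow> nat \<Rightarrow> (nat \<Rightarrow> int) set set" where
  "grid d s t = cell d s t ` lattice d"

definition cell_mass ::
  "nat \<Rightarrow> nat \<Rightarrow> ((nat \<Rightarrow> int) \<Rightarrow> real) \<Rightarrow> (nat \<Rightarrow> int) set \<Rightarrow> real" where
  "cell_mass d \<Delta> v Q = (\<Sum>p\<in>cube d \<Delta> \<inter> Q. v p)"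

text \<open>The concatenation over the levels \<open>t = 0, \<dots>, l\<close> (with \<open>\<Delta> = 2\<^sup>l\<close>) is indexed by pairs of a
  level and a cell of that level.\<close>

definition grid_index :: "nat \<Rightarrow> nat \<Rightarrow> (nat \<Rightarrow> int) \<Rightarrow> (nat \<times> (nat \<Rightarrow> int) set) set" where
  "grid_index d l s = (SIGMA t:{..l}. grid d s t)"

definition grid_vec ::
  "nat \<Rightarrow> nat \<Rightarrow> ((nat \<Rightarrow> int) \<Rightarrow> real) \<Rightarrow> nat \<times> (nat \<Rightarrow> int) set \<Rightarrow> real" where
  "grid_vec d l v = (\<lambda>(t, Q). 2 ^ t * cell_mass d (2 ^ l) v Q)"

definition grid_norm :: "nat \<Rightarrow> nat \<Rightarrow> (nat \<Rightarrow> int) \<Rightarrow> ((nat \<Rightarrow> int) \<Rightarrow> real) \<Rightarrow> real" where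
  "grid_norm d l s v = l1_norm (grid_index d l s) (grid_vec d l v)"


lemma finite_cube: "finite (cube d \<Delta>)"
  unfolding cube_def by (rule finite_PiE) auto

lemma cube_subset_lattice: "cube d \<Delta> \<subseteq> lattice d"
  unfolding cube_def lattice_def by (auto simp: PiE_iff)

lemma l1_norm_finite: "finite I \<Longrightarrow> l1_norm I v = (\<Sum>i\<in>I. \<bar>v i\<bar>)"
  unfolding l1_norm_def by (simp add: infsum_finite)

text \<open>The grids have infinitely many cells, but only finitely many of them meet the cube, so the
  infinite sum in \<^const>\<open>grid_norm\<close> is a finite one.\<close>

lemma cell_unique:
  assumes "p \<in> cell d s t c" "p \<in> cell d s t c'" "c \<in> lattice d" "c' \<in> lattice d"
  shows "c = c'"
proof (rule PiE_ext)
  show "c \<in> {..<d} \<rightarrow>\<^sub>E UNIV" "c' \<in> {..<d} \<rightarrow>\<^sub>E UNIV"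
    using assms by (auto simp: lattice_def)
  fix m assume m: "m \<in> {..<d}"
  have "2 ^ t * c m \<le> p m - s m" "p m - s m < 2 ^ t * (c m + 1)"
    "2 ^ t * c' m \<le> p m - s m" "p m - s m < 2 ^ t * (c' m + 1)"
    using assms(1,2) m by (auto simp: cell_def algebra_simps)
  then have "2 ^ t * c m < 2 ^ t * (c' m + 1)" "2 ^ t * c' m < 2 ^ t * (c m + 1)"
    by linarith+
  then show "c m = c' m" by simp
qed

lemma finite_cells_meeting_cube:
  "finite {(t, Q) \<in> grid_index d l s. cube d \<Delta> \<inter> Q \<noteq> {}}"
proof (rule finite_subset)
  show "{(t, Q) \<in> grid_index d l s. cube d \<Delta> \<inter> Q \<noteq> {}}
      \<subseteq> (\<lambda>(t, p). (t, THE Q. Q \<in> grid d s t \<and> p \<in> Q)) ` ({..l} \<times> cube d \<Delta>)"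
  proof
    fix x assume "x \<in> {(t, Q) \<in> grid_index d l s. cube d \<Delta> \<inter> Q \<noteq> {}}"
    then obtain t Q p where x: "x = (t, Q)" and tQ: "(t, Q) \<in> grid_index d l s"
      and p: "p \<in> cube d \<Delta>" "p \<in> Q" by auto
    have Q: "Q \<in> grid d s t" "t \<le> l" using tQ by (auto simp: grid_index_def)
    have "(THE Q. Q \<in> grid d s t \<and> p \<in> Q) = Q"
    proof (rule the_equality)
      fix Q' assume "Q' \<in> grid d s t \<and> p \<in> Q'"
      then show "Q' = Q" using Q p cell_unique unfolding grid_def by blast
    qed (use Q p in auto)
    then show "x \<in> (\<lambda>(t, p). (t, THE Q. Q \<in> grid d s t \<and> p \<in> Q)) ` ({..l} \<times> cube d \<Delta>)"
      using Q p x by (intro image_eqI[where x = "(t, p)"]) simp_all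
  qed
  show "finite ((\<lambda>(t, p). (t, THE Q. Q \<in> grid d s t \<and> p \<in> Q)) ` ({..l} \<times> cube d \<Delta>))"
    by (intro finite_imageI finite_cartesian_product finite_cube) auto
qed

lemma grid_norm_finite_sum:
  "grid_norm d l s v =
    (\<Sum>x\<in>{(t, Q) \<in> grid_index d l s. cube d (2 ^ l) \<inter> Q \<noteq> {}}. \<bar>grid_vec d l v x\<bar>)"
  (is "_ = sum _ ?J")
proof -
  have "grid_norm d l s v = (\<Sum>\<^sub>\<infinity>x\<in>?J. \<bar>grid_vec d l v x\<bar>)"
    unfolding grid_norm_def l1_norm_def
    by (rule infsum_cong_neutral) (auto simp: grid_vec_def cell_mass_def)
  also have "\<dots> = (\<Sum>x\<in>?J. \<bar>grid_vec d l v x\<bar>)"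
    by (rule infsum_finite) (rule finite_cells_meeting_cube)
  finally show ?thesis .
qed

text \<open>Without equality of the total masses, the bound with the factor \<open>O(\<surd>d)\<close> fails: an
  unmatched unit of mass costs \<open>d * \<Delta>\<close> but contributes less than \<open>2 * \<Delta>\<close> to the grid norm.
  Already \<open>\<Delta> = 1\<close>, with a unit mass against the zero measure, is a counterexample.\<close>

lemma unbalanced_bound_fails:
  "\<not> (\<exists>C>0. \<forall>(d::nat) (l::nat) (\<mu> :: (nat \<Rightarrow> int) \<Rightarrow> real) \<nu> s.
      nonneg_on (cube d (2 ^ l)) \<mu> \<longrightarrow> nonneg_on (cube d (2 ^ l)) \<nu> \<longrightarrow> s \<in> lattice d \<longrightarrow>
      emd_norm d (2 ^ l) (\<mu> - \<nu>) \<le> C * sqrt (real d) * grid_norm d l s (\<mu> - \<nu>))"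
proof
  define e :: "(nat \<Rightarrow> int) \<Rightarrow> real" where "e = (\<lambda>_. 1)"
  define z :: "(nat \<Rightarrow> int) \<Rightarrow> real" where "z = (\<lambda>_. 0)"
  assume "\<exists>C>0. \<forall>(d::nat) (l::nat) (\<mu> :: (nat \<Rightarrow> int) \<Rightarrow> real) \<nu> s.
      nonneg_on (cube d (2 ^ l)) \<mu> \<longrightarrow> nonneg_on (cube d (2 ^ l)) \<nu> \<longrightarrow> s \<in> lattice d \<longrightarrow>
      emd_norm d (2 ^ l) (\<mu> - \<nu>) \<le> C * sqrt (real d) * grid_norm d l s (\<mu> - \<nu>)"
  then obtain C :: real where C: "C > 0" and bound:
    "\<And>(d::nat) (l::nat) (\<mu> :: (nat \<Rightarrow> int) \<Rightarrow> real) \<nu> s.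
      nonneg_on (cube d (2 ^ l)) \<mu> \<Longrightarrow> nonneg_on (cube d (2 ^ l)) \<nu> \<Longrightarrow> s \<in> lattice d \<Longrightarrow>
      emd_norm d (2 ^ l) (\<mu> - \<nu>) \<le> C * sqrt (real d) * grid_norm d l s (\<mu> - \<nu>)"
    by blast
  obtain n :: nat where n: "C < real n" using reals_Archimedean2 by blast
  define d where "d = n ^ 2"
  define p :: "nat \<Rightarrow> int" where "p = (\<lambda>m\<in>{..<d}. 1)"
  have cube: "cube d (Suc 0) = {p}"
    unfolding cube_def p_def by (auto simp: PiE_iff fun_eq_iff extensional_def)
  have p: "p \<in> lattice d" unfolding lattice_def p_def by auto
  have pos: "pos_part (e - z) = e" "neg_part (e - z) = z"
    by (auto simp: pos_part_def neg_part_def e_def z_def fun_eq_iff)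
  have dist: "dist2 d p p = 0" by (simp add: dist2_def L2_set_def)
  have bal: "emd_balanced d (Suc 0) x y = 0" if "x p = y p" "x p \<ge> 0" for x y
  proof -
    have "(\<lambda>_ _. x p) \<in> couplings d (Suc 0) x y"
      using that by (simp add: couplings_def cube)
    then have ne: "couplings d (Suc 0) x y \<noteq> {}" by blast
    show ?thesis unfolding emd_balanced_def using ne by (simp add: cube dist)
  qed
  have "emd d (Suc 0) e z = real d"
  proof -
    have "{emd_balanced d (Suc 0) x' y'
            + real d * real (Suc 0) * (l1_norm (cube d (Suc 0)) (e - x') + l1_norm (cube d (Suc 0)) (z - y')) | x' y'.
          (\<forall>i\<in>cube d (Suc 0). 0 \<le> x' i \<and> x' i \<le> e i) \<and>
          (\<forall>i\<in>cube d (Suc 0). 0 \<le> y' i \<and> y' i \<le> z i) \<and>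
          l1_norm (cube d (Suc 0)) x' = l1_norm (cube d (Suc 0)) y'} = {real d}" (is "?S = _")
    proof (intro equalityI subsetI)
      fix r assume "r \<in> ?S"
      then obtain x' y' where r: "r = emd_balanced d (Suc 0) x' y'
            + real d * real (Suc 0) * (l1_norm (cube d (Suc 0)) (e - x') + l1_norm (cube d (Suc 0)) (z - y'))"
        and h: "0 \<le> y' p" "y' p \<le> 0" "\<bar>x' p\<bar> = \<bar>y' p\<bar>"
        by (auto simp: cube l1_norm_finite z_def)
      then have "x' p = 0" "y' p = 0" by auto
      then show "r \<in> {real d}"
        by (simp add: r bal) (simp add: cube l1_norm_finite e_def z_def)
    next
      fix r assume "r \<in> {real d}"
      moreover have "real d \<in> ?S"
        by (rule CollectI, rule exI[of _ z], rule exI[of _ z])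
          (simp add: bal z_def, simp add: cube l1_norm_finite e_def)
      ultimately show "r \<in> ?S" by simp
    qed
    then show ?thesis unfolding emd_def by (simp add: cube l1_norm_finite e_def z_def)
  qed
  then have emd: "emd_norm d (2 ^ 0) (e - z) = real d" by (simp add: emd_norm_def pos)
  have "{(t, Q) \<in> grid_index d 0 p. cube d (2 ^ 0) \<inter> Q \<noteq> {}} = {(0, cell d p 0 (\<lambda>m\<in>{..<d}. 0))}"
  proof (intro equalityI subsetI)
    fix x assume "x \<in> {(t, Q) \<in> grid_index d 0 p. cube d (2 ^ 0) \<inter> Q \<noteq> {}}"
    then obtain c where x: "x = (0, cell d p 0 c)" and c: "c \<in> lattice d" "p \<in> cell d p 0 c"
      by (auto simp: grid_index_def grid_def cube)
    have "c = (\<lambda>m\<in>{..<d}. 0)"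
      by (rule cell_unique[OF c(2) _ c(1)]) (use p in \<open>auto simp: cell_def lattice_def\<close>)
    then show "x \<in> {(0, cell d p 0 (\<lambda>m\<in>{..<d}. 0))}" using x by simp
  next
    have "p \<in> cell d p 0 (\<lambda>m\<in>{..<d}. 0)" using p by (auto simp: cell_def)
    moreover have "cell d p 0 (\<lambda>m\<in>{..<d}. 0) \<in> grid d p 0"
      unfolding grid_def by (rule imageI) (unfold lattice_def, rule restrict_PiE_iff[THEN iffD2], simp)
    moreover fix x :: "nat \<times> (nat \<Rightarrow> int) set" assume "x \<in> {(0, cell d p 0 (\<lambda>m\<in>{..<d}. 0))}"
    ultimately show "x \<in> {(t, Q) \<in> grid_index d 0 p. cube d (2 ^ 0) \<inter> Q \<noteq> {}}"
      by (auto simp: grid_index_def cube)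
  qed
  moreover have "{p} \<inter> cell d p 0 (\<lambda>m\<in>{..<d}. 0) = {p}" using p by (auto simp: cell_def)
  ultimately have grid: "grid_norm d 0 p (e - z) = 1"
    unfolding grid_norm_finite_sum by (simp add: grid_vec_def cell_mass_def cube e_def z_def)
  have "emd_norm d (2 ^ 0) (e - z) \<le> C * sqrt (real d) * grid_norm d 0 p (e - z)"
    by (rule bound) (auto simp: nonneg_on_def e_def z_def p)
  then have "real d \<le> C * sqrt (real d)" using emd grid by simp
  then have "real n * real n \<le> C * real n" by (simp add: d_def power2_eq_square)
  moreover have "C * real n < real n * real n" using n C by simp
  ultimately show False by simp
qed

end

theory Submission
  imports Defs
begin

text \<open>A cell hierarchy turns the cube into a tree metric in which two points have distance
  \<open>\<Sum> 2\<^sup>t\<close> over the levels \<open>t\<close> whose grid separates them, and the grid norm of \<open>v\<close> is twice the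
  earth mover distance of \<open>v\<^sup>+\<close> and \<open>v\<^sup>-\<close> for that tree metric: every coupling costs at least half
  the grid norm, and the greedy coupling, which always matches the closest remaining pair, costs
  exactly that.  Hence the upper bound on the earth mover distance reduces to the pointwise bound
  of the Euclidean distance by \<open>2 \<surd>d\<close> times the tree distance.

  Conversely, for random \<open>s\<close> a pair at Euclidean distance \<open>D\<close> is separated at level \<open>t\<close> with
  probability at most \<open>\<surd>d D / 2\<^sup>t\<close>, so each level with \<open>2\<^sup>t > D\<close> contributes at most \<open>\<surd>d D\<close>
  to the expected tree distance, and all levels with \<open>2\<^sup>t \<le> D\<close> together contribute at most \<open>2 D\<close>.
  With probability at least \<open>1 - 1/2000\<close> no point of the support of \<open>\<mu>\<close> lies within \<open>2\<^sup>t / K\<close>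
  of a level \<open>t\<close> boundary, where \<open>K = 4000 k d (l + 1)\<close>; then the levels with \<open>2\<^sup>t > K D\<close> do not
  contribute at all, which leaves only \<open>log K + O(1)\<close> levels, and Markov's inequality applies.\<close>

section \<open>Tree metrics and greedy couplings\<close>

text \<open>The partition of level \<open>t\<close> is given by a labeling \<open>\<pi> t\<close>,
  whose fibres in \<open>S\<close> are the cells. Summing over the image of \<open>S\<close> leaves
  out the cells that miss \<open>S\<close>.\<close>

definition level_norm :: "'a set \<Rightarrow> nat \<Rightarrow> (nat \<Rightarrow> 'a \<Rightarrow> 'b) \<Rightarrow> ('a \<Rightarrow> real) \<Rightarrow> real" where
  "level_norm S l \<pi> v = (\<Sum>t\<le>l. 2 ^ t * (\<Sum>c\<in>\<pi> t ` S. \<bar>\<Sum>p\<in>{p\<in>S. \<pi> t p = c}. v p\<bar>))"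

text \<open>For nested partitions the separating levels form an initial segment, so if there are
  \<open>n\<close> of them the value is \<open>2 ^ n - 1\<close>, which is a
  pseudo-ultrametric.\<close>

definition tree_dist :: "nat \<Rightarrow> (nat \<Rightarrow> 'a \<Rightarrow> 'b) \<Rightarrow> 'a \<Rightarrow> 'a \<Rightarrow> real" where
  "tree_dist l \<pi> i j = (\<Sum>t\<le>l. 2 ^ t * of_bool (\<pi> t i \<noteq> \<pi> t j))"

lemma level_norm_nonneg: "0 \<le> level_norm S l \<pi> v"
  unfolding level_norm_def by (intro sum_nonneg mult_nonneg_nonneg) auto

lemma tree_dist_nonneg: "0 \<le> tree_dist l \<pi> i j"
  unfolding tree_dist_def by (intro sum_nonneg) auto

lemma sum_class_of_bool:
  fixes v :: "'a \<Rightarrow> real"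
  assumes "finite S"
  shows "(\<Sum>p\<in>{p\<in>S. \<pi> p = c}. v p) = (\<Sum>p\<in>S. v p * of_bool (\<pi> p = c))"
proof -
  have "{p\<in>S. \<pi> p = c} = S \<inter> {p. \<pi> p = c}" by auto
  then show ?thesis using assms by simp
qed

text \<open>A unit of flow from \<open>i\<close> to \<open>j\<close> adds 1 to the mass of the label
  of \<open>i\<close> and takes 1 from that of \<open>j\<close>. It thus costs at most 2 on a level
  that separates the points and nothing on the others.\<close>

lemma level_norm_le_tree_cost:
  assumes S: "finite S" and f: "\<And>i j. i \<in> S \<Longrightarrow> j \<in> S \<Longrightarrow> 0 \<le> f i j"
    and v: "\<And>i. i \<in> S \<Longrightarrow> v i = (\<Sum>j\<in>S. f i j) - (\<Sum>j\<in>S. f j i)"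
  shows "level_norm S l \<pi> v \<le> 2 * (\<Sum>i\<in>S. \<Sum>j\<in>S. f i j * tree_dist l \<pi> i j)"
proof -
  have level: "(\<Sum>c\<in>\<pi> t ` S. \<bar>\<Sum>p\<in>{p\<in>S. \<pi> t p = c}. v p\<bar>)
      \<le> (\<Sum>i\<in>S. \<Sum>j\<in>S. f i j * (2 * of_bool (\<pi> t i \<noteq> \<pi> t j)))" for t
  proof -
    define g :: "'a \<Rightarrow> 'b \<Rightarrow> real" where "g i c = of_bool (\<pi> t i = c)" for i c
    have "(\<Sum>c\<in>\<pi> t ` S. \<bar>\<Sum>p\<in>{p\<in>S. \<pi> t p = c}. v p\<bar>)
        \<le> (\<Sum>c\<in>\<pi> t ` S. \<Sum>i\<in>S. \<Sum>j\<in>S. f i j * \<bar>g i c - g j c\<bar>)"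
    proof (rule sum_mono)
      fix c
      have "(\<Sum>p\<in>{p\<in>S. \<pi> t p = c}. v p) = (\<Sum>p\<in>S. v p * g p c)"
        unfolding g_def by (rule sum_class_of_bool[OF S])
      also have "\<dots> = (\<Sum>i\<in>S. \<Sum>j\<in>S. f i j * g i c) - (\<Sum>i\<in>S. \<Sum>j\<in>S. f j i * g i c)"
        by (simp add: v left_diff_distrib sum_subtractf sum_distrib_right)
      \<comment> \<open>Exchanging the roles of \<open>i\<close> and \<open>j\<close> writes both
        marginals over the same flow \<open>f i j\<close>, so only \<open>g i c - g j c\<close>
        remains.\<close>
      also have "(\<Sum>i\<in>S. \<Sum>j\<in>S. f j i * g i c) = (\<Sum>i\<in>S. \<Sum>j\<in>S. f i j * g j c)"
        by (rule sum.swap)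
      finally have "(\<Sum>p\<in>{p\<in>S. \<pi> t p = c}. v p) = (\<Sum>i\<in>S. \<Sum>j\<in>S. f i j * (g i c - g j c))"
        by (simp add: sum_subtractf right_diff_distrib)
      also have "\<bar>\<dots>\<bar> \<le> (\<Sum>i\<in>S. \<bar>\<Sum>j\<in>S. f i j * (g i c - g j c)\<bar>)"
        by (rule sum_abs)
      also have "\<dots> \<le> (\<Sum>i\<in>S. \<Sum>j\<in>S. \<bar>f i j * (g i c - g j c)\<bar>)"
        by (intro sum_mono sum_abs)
      also have "\<dots> = (\<Sum>i\<in>S. \<Sum>j\<in>S. f i j * \<bar>g i c - g j c\<bar>)"
        using f by (intro sum.cong refl) (simp add: abs_mult)
      finally show "\<bar>\<Sum>p\<in>{p\<in>S. \<pi> t p = c}. v p\<bar> \<le> (\<Sum>i\<in>S. \<Sum>j\<in>S. f i j * \<bar>g i c - g j c\<bar>)" .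
    qed
    also have "\<dots> = (\<Sum>i\<in>S. \<Sum>c\<in>\<pi> t ` S. \<Sum>j\<in>S. f i j * \<bar>g i c - g j c\<bar>)"
      by (rule sum.swap)
    also have "\<dots> = (\<Sum>i\<in>S. \<Sum>j\<in>S. \<Sum>c\<in>\<pi> t ` S. f i j * \<bar>g i c - g j c\<bar>)"
      by (intro sum.cong refl sum.swap)
    also have "\<dots> = (\<Sum>i\<in>S. \<Sum>j\<in>S. f i j * (2 * of_bool (\<pi> t i \<noteq> \<pi> t j)))"
    proof (intro sum.cong refl)
      fix i j assume ij: "i \<in> S" "j \<in> S"
      have "(\<Sum>c\<in>\<pi> t ` S. \<bar>g i c - g j c\<bar>) = 2 * of_bool (\<pi> t i \<noteq> \<pi> t j)"
      proof (cases "\<pi> t i = \<pi> t j")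
        case False
        have "(\<Sum>c\<in>\<pi> t ` S. \<bar>g i c - g j c\<bar>)
            = (\<Sum>c\<in>\<pi> t ` S. (if \<pi> t i = c then 1 else 0) + (if \<pi> t j = c then 1 else 0))"
          using False by (intro sum.cong refl) (auto simp: g_def)
        also have "\<dots> = 2" using S ij by (simp add: sum.distrib)
        finally show ?thesis using False by simp
      qed (simp add: g_def)
      then show "(\<Sum>c\<in>\<pi> t ` S. f i j * \<bar>g i c - g j c\<bar>) = f i j * (2 * of_bool (\<pi> t i \<noteq> \<pi> t j))"
        by (simp flip: sum_distrib_left)
    qed
    finally show ?thesis .
  qed
  have "level_norm S l \<pi> v
      \<le> (\<Sum>t\<le>l. 2 ^ t * (\<Sum>i\<in>S. \<Sum>j\<in>S. f i j * (2 * of_bool (\<pi> t i \<noteq> \<pi> t j))))"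
    unfolding level_norm_def using level by (intro sum_mono mult_left_mono) auto
  also have "\<dots> = (\<Sum>t\<le>l. \<Sum>i\<in>S. \<Sum>j\<in>S. 2 * (f i j * (2 ^ t * of_bool (\<pi> t i \<noteq> \<pi> t j))))"
    by (simp add: sum_distrib_left mult_ac)
  also have "\<dots> = (\<Sum>i\<in>S. \<Sum>t\<le>l. \<Sum>j\<in>S. 2 * (f i j * (2 ^ t * of_bool (\<pi> t i \<noteq> \<pi> t j))))"
    by (rule sum.swap)
  also have "\<dots> = (\<Sum>i\<in>S. \<Sum>j\<in>S. \<Sum>t\<le>l. 2 * (f i j * (2 ^ t * of_bool (\<pi> t i \<noteq> \<pi> t j))))"
    by (intro sum.cong refl sum.swap)
  also have "\<dots> = 2 * (\<Sum>i\<in>S. \<Sum>j\<in>S. f i j * tree_dist l \<pi> i j)"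
    by (simp only: tree_dist_def sum_distrib_left)
  finally show ?thesis .
qed

text \<open>The last two hypotheses hold for a closest pair \<open>i\<close>, \<open>j\<close>: each cell separating them carries
  mass of one sign only, so moving mass out of it cancels nothing.\<close>

lemma level_norm_move_mass:
  fixes x y :: "'a \<Rightarrow> real"
  assumes S: "finite S" and x: "\<And>p. p \<in> S \<Longrightarrow> 0 \<le> x p" and y: "\<And>p. p \<in> S \<Longrightarrow> 0 \<le> y p"
    and ij: "i \<in> S" "j \<in> S" and m: "0 \<le> m" "m \<le> x i" "m \<le> y j"
    and i: "\<And>t q. \<lbrakk>t \<le> l; \<pi> t i \<noteq> \<pi> t j; q \<in> S; \<pi> t q = \<pi> t i\<rbrakk> \<Longrightarrow> y q = 0"
    and j: "\<And>t p. \<lbrakk>t \<le> l; \<pi> t i \<noteq> \<pi> t j; p \<in> S; \<pi> t p = \<pi> t j\<rbrakk> \<Longrightarrow> x p = 0"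
  shows "level_norm S l \<pi> (x(i := x i - m) - y(j := y j - m)) + 2 * (m * tree_dist l \<pi> i j)
    \<le> level_norm S l \<pi> (x - y)"
proof -
  define w where "w = x(i := x i - m) - y(j := y j - m)"
  define \<sigma> where "\<sigma> v t c = (\<Sum>p\<in>{p\<in>S. \<pi> t p = c}. v p)" for v :: "'a \<Rightarrow> real" and t c
  define b :: "nat \<Rightarrow> real" where "b t = of_bool (\<pi> t i \<noteq> \<pi> t j)" for t
  have w_eq: "w p = (x p - y p) - (if i = p then m else 0) + (if j = p then m else 0)" for p
    by (auto simp: w_def)
  have w: "\<sigma> w t c = \<sigma> x t c - \<sigma> y t c - (if \<pi> t i = c then m else 0) + (if \<pi> t j = c then m else 0)" for t c
    unfolding \<sigma>_def w_eq using S ij by (simp add: sum.distrib sum_subtractf sum.If_cases)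
  have level: "(\<Sum>c\<in>\<pi> t ` S. \<bar>\<sigma> w t c\<bar>) + 2 * m * b t \<le> (\<Sum>c\<in>\<pi> t ` S. \<bar>\<sigma> (x - y) t c\<bar>)"
    if t: "t \<le> l" for t
  proof -
    have "\<bar>\<sigma> w t c\<bar> + ((if \<pi> t i = c then m * b t else 0) + (if \<pi> t j = c then m * b t else 0))
        \<le> \<bar>\<sigma> (x - y) t c\<bar>" for c
    proof (cases "\<pi> t i \<noteq> \<pi> t j \<and> (c = \<pi> t i \<or> c = \<pi> t j)")
      \<comment> \<open>If \<open>i\<close> and \<open>j\<close> share a label, the two corrections
        by \<open>m\<close> cancel and \<open>b t\<close> is 0; a cell that contains neither point
        is not changed.\<close>
      case False
      then show ?thesis using w[of t c] by (auto simp: b_def \<sigma>_def sum_subtractf)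
    next
      case True
      have v: "\<sigma> (x - y) t c = \<sigma> x t c - \<sigma> y t c" by (simp add: \<sigma>_def sum_subtractf)
      from True consider "c = \<pi> t i" | "c = \<pi> t j" by auto
      then show ?thesis
      proof cases
        case 1
        \<comment> \<open>The cell carries mass of \<open>x\<close> only, at least
          \<open>x i \<ge> m\<close>, so removing \<open>m\<close> lowers its absolute mass by
          exactly \<open>m\<close>.\<close>
        have "\<sigma> y t c = 0" unfolding \<sigma>_def using i[OF t] True 1 by (intro sum.neutral) auto
        moreover have "x i \<le> \<sigma> x t c" unfolding \<sigma>_def using S ij 1 x by (intro member_le_sum) auto
        ultimately show ?thesis using True 1 w[of t c] m v by (auto simp: b_def)
      next
        case 2
        have "\<sigma> x t c = 0" unfolding \<sigma>_def using j[OF t] True 2 by (intro sum.neutral) auto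
        moreover have "y j \<le> \<sigma> y t c" unfolding \<sigma>_def using S ij 2 y by (intro member_le_sum) auto
        ultimately show ?thesis using True 2 w[of t c] m v by (auto simp: b_def)
      qed
    qed
    then have "(\<Sum>c\<in>\<pi> t ` S. \<bar>\<sigma> w t c\<bar>
          + ((if \<pi> t i = c then m * b t else 0) + (if \<pi> t j = c then m * b t else 0)))
        \<le> (\<Sum>c\<in>\<pi> t ` S. \<bar>\<sigma> (x - y) t c\<bar>)"
      by (intro sum_mono)
    then show ?thesis using S ij by (simp add: sum.distrib)
  qed
  have tree: "tree_dist l \<pi> i j = (\<Sum>t\<le>l. 2 ^ t * b t)"
    by (simp only: tree_dist_def b_def)
  have "level_norm S l \<pi> w + 2 * (m * tree_dist l \<pi> i j)
      = (\<Sum>t\<le>l. 2 ^ t * ((\<Sum>c\<in>\<pi> t ` S. \<bar>\<sigma> w t c\<bar>) + 2 * m * b t))"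
    unfolding tree level_norm_def \<sigma>_def by (simp add: sum.distrib sum_distrib_left distrib_left mult_ac)
  also have "\<dots> \<le> (\<Sum>t\<le>l. 2 ^ t * (\<Sum>c\<in>\<pi> t ` S. \<bar>\<sigma> (x - y) t c\<bar>))"
    using level by (intro sum_mono mult_left_mono) auto
  finally show ?thesis by (simp add: level_norm_def \<sigma>_def w_def)
qed

text \<open>Induction on the number of nonzero entries. Matching as much as possible between a
  closest pair empties one of its two entries and, by \<open>level_norm_move_mass\<close>, lowers
  the level norm by at least twice the cost. If the totals differ, the procedure stops when the
  smaller one is used up, and the remaining level norm is nonnegative.\<close>

lemma greedy_partial_coupling:
  fixes x y :: "'a \<Rightarrow> real"
  assumes S: "finite S"
    and nested: "\<And>t t' p q. \<lbrakk>t \<le> t'; p \<in> S; q \<in> S; \<pi> t p = \<pi> t q\<rbrakk> \<Longrightarrow> \<pi> t' p = \<pi> t' q"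
    and "\<And>p. p \<in> S \<Longrightarrow> 0 \<le> x p" "\<And>p. p \<in> S \<Longrightarrow> 0 \<le> y p"
  obtains f :: "'a \<Rightarrow> 'a \<Rightarrow> real" where "\<And>i j. 0 \<le> f i j"
    "\<And>i. i \<in> S \<Longrightarrow> (\<Sum>j\<in>S. f i j) \<le> x i" "\<And>j. j \<in> S \<Longrightarrow> (\<Sum>i\<in>S. f i j) \<le> y j"
    "(\<Sum>i\<in>S. \<Sum>j\<in>S. f i j) = min (sum x S) (sum y S)"
    "2 * (\<Sum>i\<in>S. \<Sum>j\<in>S. f i j * tree_dist l \<pi> i j) \<le> level_norm S l \<pi> (x - y)"
proof -
  have "\<exists>f. (\<forall>i j. 0 \<le> f i j) \<and> (\<forall>i\<in>S. (\<Sum>j\<in>S. f i j) \<le> x i) \<and> (\<forall>j\<in>S. (\<Sum>i\<in>S. f i j) \<le> y j) \<and>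
      (\<Sum>i\<in>S. \<Sum>j\<in>S. f i j) = min (sum x S) (sum y S) \<and>
      2 * (\<Sum>i\<in>S. \<Sum>j\<in>S. f i j * tree_dist l \<pi> i j) \<le> level_norm S l \<pi> (x - y)"
    using assms(3,4)
  proof (induction "card {p\<in>S. x p \<noteq> 0} + card {p\<in>S. y p \<noteq> 0}" arbitrary: x y rule: less_induct)
    case less
    note x = less.prems(1) and y = less.prems(2)
    show ?case
    proof (cases "(\<forall>p\<in>S. x p = 0) \<or> (\<forall>p\<in>S. y p = 0)")
      case True
      then have "min (sum x S) (sum y S) = 0"
        using x y by (auto simp: sum_nonneg min_def intro!: antisym)
      then show ?thesis using x y level_norm_nonneg[of S l \<pi> "x - y"]
        by (intro exI[of _ "\<lambda>_ _. 0"]) auto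
    next
      case False
      define P where "P = {p\<in>S. x p \<noteq> 0} \<times> {q\<in>S. y q \<noteq> 0}"
      have P: "finite P" "P \<noteq> {}" using S False by (auto simp: P_def)
      obtain i j where ij_P: "(i, j) \<in> P"
        and least: "\<And>p q. (p, q) \<in> P \<Longrightarrow> tree_dist l \<pi> i j \<le> tree_dist l \<pi> p q"
        using ex_is_arg_min_if_finite[OF P, of "case_prod (tree_dist l \<pi>)"]
        by (force simp: is_arg_min_linorder)
      have ij: "i \<in> S" "j \<in> S" "x i > 0" "y j > 0"
        using ij_P x[of i] y[of j] by (auto simp: P_def less_le)
      \<comment> \<open>Agreement at level \<open>t\<close> passes to all coarser levels and
        separation at \<open>t\<close> to all finer ones. So the comparison holds level by level and
        is strict at \<open>t\<close>.\<close>
      have closer: "tree_dist l \<pi> p q < tree_dist l \<pi> p' q'"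
        if "p \<in> S" "q \<in> S" "p' \<in> S" "q' \<in> S" "t \<le> l" "\<pi> t p = \<pi> t q" "\<pi> t p' \<noteq> \<pi> t q'" for p q p' q' t
        unfolding tree_dist_def
      proof (rule sum_strict_mono_ex1)
        show "\<forall>u\<in>{..l}. 2 ^ u * of_bool (\<pi> u p \<noteq> \<pi> u q) \<le> (2 ^ u * of_bool (\<pi> u p' \<noteq> \<pi> u q') :: real)"
        proof
          fix u
          show "2 ^ u * of_bool (\<pi> u p \<noteq> \<pi> u q) \<le> (2 ^ u * of_bool (\<pi> u p' \<noteq> \<pi> u q') :: real)"
            using nested[of t u p q] nested[of u t p' q'] that by (cases "t \<le> u") auto
        qed
        show "\<exists>u\<in>{..l}. 2 ^ u * of_bool (\<pi> u p \<noteq> \<pi> u q) < (2 ^ u * of_bool (\<pi> u p' \<noteq> \<pi> u q') :: real)"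
          using that by (intro bexI[of _ t]) auto
      qed simp
      define m where "m = min (x i) (y j)"
      have m: "0 \<le> m" "m \<le> x i" "m \<le> y j" using ij by (auto simp: m_def)
      define x' y' where "x' = x(i := x i - m)" and "y' = y(j := y j - m)"
      have "{p\<in>S. x' p \<noteq> 0} \<subseteq> {p\<in>S. x p \<noteq> 0}" "{p\<in>S. y' p \<noteq> 0} \<subseteq> {p\<in>S. y p \<noteq> 0}"
        using ij by (auto simp: x'_def y'_def)
      moreover have "i \<notin> {p\<in>S. x' p \<noteq> 0} \<or> j \<notin> {p\<in>S. y' p \<noteq> 0}"
        by (auto simp: x'_def y'_def m_def min_def)
      moreover have "i \<in> {p\<in>S. x p \<noteq> 0}" "j \<in> {p\<in>S. y p \<noteq> 0}"
        using ij by auto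
      ultimately have sub: "{p\<in>S. x' p \<noteq> 0} \<subseteq> {p\<in>S. x p \<noteq> 0}" "{p\<in>S. y' p \<noteq> 0} \<subseteq> {p\<in>S. y p \<noteq> 0}"
        "{p\<in>S. x' p \<noteq> 0} \<subset> {p\<in>S. x p \<noteq> 0} \<or> {p\<in>S. y' p \<noteq> 0} \<subset> {p\<in>S. y p \<noteq> 0}"
        by blast+
      have fin: "finite {p\<in>S. x p \<noteq> 0}" "finite {p\<in>S. y p \<noteq> 0}" using S by auto
      have "card {p\<in>S. x' p \<noteq> 0} + card {p\<in>S. y' p \<noteq> 0} < card {p\<in>S. x p \<noteq> 0} + card {p\<in>S. y p \<noteq> 0}"
        using sub(3)
      proof
        assume "{p\<in>S. x' p \<noteq> 0} \<subset> {p\<in>S. x p \<noteq> 0}"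
        then show ?thesis by (intro add_less_le_mono psubset_card_mono card_mono fin sub)
      next
        assume "{p\<in>S. y' p \<noteq> 0} \<subset> {p\<in>S. y p \<noteq> 0}"
        then show ?thesis by (intro add_le_less_mono psubset_card_mono card_mono fin sub)
      qed
      moreover have "0 \<le> x' p" "0 \<le> y' p" if "p \<in> S" for p
        using x y m that by (auto simp: x'_def y'_def)
      ultimately obtain g where g: "\<And>p q. 0 \<le> g p q" "\<And>p. p \<in> S \<Longrightarrow> (\<Sum>q\<in>S. g p q) \<le> x' p"
          "\<And>q. q \<in> S \<Longrightarrow> (\<Sum>p\<in>S. g p q) \<le> y' q"
          "(\<Sum>p\<in>S. \<Sum>q\<in>S. g p q) = min (sum x' S) (sum y' S)"
          "2 * (\<Sum>p\<in>S. \<Sum>q\<in>S. g p q * tree_dist l \<pi> p q) \<le> level_norm S l \<pi> (x' - y')"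
        using less.hyps[of x' y'] by blast
      define f where "f p q = g p q + (if j = q then (if i = p then m else 0) else 0)" for p q
      \<comment> \<open>Both nesting orders of the conditionals are kept: \<open>f_def\<close>
        collapses under a sum over \<open>q\<close>, and this form under a sum over
        \<open>p\<close>.\<close>
      have f': "f p q = g p q + (if i = p then (if j = q then m else 0) else 0)" for p q
        by (simp add: f_def)
      have row: "(\<Sum>q\<in>S. f p q) = (\<Sum>q\<in>S. g p q) + (if i = p then m else 0)" for p
        using S ij by (simp add: f_def sum.distrib)
      have col: "(\<Sum>p\<in>S. f p q) = (\<Sum>p\<in>S. g p q) + (if j = q then m else 0)" for q
        using S ij by (simp add: f' sum.distrib)
      have x'_eq: "x' p = x p - (if i = p then m else 0)" and y'_eq: "y' p = y p - (if j = p then m else 0)" for p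
        by (auto simp: x'_def y'_def)
      have mass: "sum x' S = sum x S - m" "sum y' S = sum y S - m"
        using S ij by (auto simp: x'_eq y'_eq sum_subtractf)
      have "f p q * tree_dist l \<pi> p q = g p q * tree_dist l \<pi> p q
          + (if j = q then (if i = p then m * tree_dist l \<pi> i j else 0) else 0)" for p q
        by (simp add: f_def distrib_right)
      then have cost: "(\<Sum>p\<in>S. \<Sum>q\<in>S. f p q * tree_dist l \<pi> p q)
          = (\<Sum>p\<in>S. \<Sum>q\<in>S. g p q * tree_dist l \<pi> p q) + m * tree_dist l \<pi> i j"
        using S ij by (simp add: sum.distrib)
      have "level_norm S l \<pi> (x' - y') + 2 * (m * tree_dist l \<pi> i j) \<le> level_norm S l \<pi> (x - y)"
        unfolding x'_def y'_def
      proof (rule level_norm_move_mass)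
        fix t q assume t: "t \<le> l" "\<pi> t i \<noteq> \<pi> t j" and q: "q \<in> S" "\<pi> t q = \<pi> t i"
        \<comment> \<open>Otherwise \<open>q\<close> would share a cell with \<open>i\<close> on a
          level that separates \<open>i\<close> from \<open>j\<close>, and \<open>(i, q)\<close>
          would be a strictly closer pair.\<close>
        show "y q = 0"
        proof (rule ccontr)
          assume "y q \<noteq> 0"
          then have "(i, q) \<in> P" using ij q by (auto simp: P_def)
          then show False using least[of i q] closer[of i q i j t] ij q t by fastforce
        qed
      next
        fix t p assume t: "t \<le> l" "\<pi> t i \<noteq> \<pi> t j" and p: "p \<in> S" "\<pi> t p = \<pi> t j"
        show "x p = 0"
        proof (rule ccontr)
          assume "x p \<noteq> 0"
          then have "(p, j) \<in> P" using ij p by (auto simp: P_def)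
          then show False using least[of p j] closer[of p j i j t] ij p t by fastforce
        qed
      qed (use S x y ij m in auto)
      then have "2 * (\<Sum>p\<in>S. \<Sum>q\<in>S. f p q * tree_dist l \<pi> p q) \<le> level_norm S l \<pi> (x - y)"
        using g(5) by (simp add: cost)
      moreover have "(\<Sum>p\<in>S. \<Sum>q\<in>S. f p q) = min (sum x S) (sum y S)"
        using g(4) S ij by (simp add: row sum.distrib mass min_def split: if_splits)
      moreover have "(\<Sum>q\<in>S. f p q) \<le> x p" "(\<Sum>q\<in>S. f q p) \<le> y p" if "p \<in> S" for p
        using g(2,3)[OF that] by (auto simp: row col x'_eq y'_eq split: if_splits)
      moreover have "0 \<le> f p q" for p q using g(1)[of p q] m by (simp add: f_def)
      ultimately show ?thesis by blast
    qed
  qed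
  then show thesis using that by blast
qed

section \<open>Grids and the earth mover distance\<close>

text \<open>The index of the cell that contains \<open>p\<close>. The restriction to
  \<open>{..<d}\<close> puts it into \<open>lattice d\<close> and makes equality of labels a
  coordinatewise matter.\<close>

definition grid_label :: "nat \<Rightarrow> (nat \<Rightarrow> int) \<Rightarrow> nat \<Rightarrow> (nat \<Rightarrow> int) \<Rightarrow> nat \<Rightarrow> int" where
  "grid_label d s t p = (\<lambda>m\<in>{..<d}. (p m - s m) div 2 ^ t)"

lemma grid_label_in_lattice: "grid_label d s t p \<in> lattice d"
  unfolding grid_label_def lattice_def by (rule restrict_PiE_iff[THEN iffD2]) simp

lemma grid_label_eq_iff:
  "grid_label d s t p = grid_label d s t q \<longleftrightarrow> (\<forall>m<d. (p m - s m) div 2 ^ t = (q m - s m) div 2 ^ t)"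
  by (auto simp: grid_label_def restrict_def fun_eq_iff)

text \<open>All levels share the corner \<open>s\<close>, and division by \<open>2 ^ t'\<close>
  factors through division by \<open>2 ^ t\<close>.\<close>

lemma grid_label_nested:
  assumes "t \<le> t'" and "grid_label d s t p = grid_label d s t q"
  shows "grid_label d s t' p = grid_label d s t' q"
proof -
  have "a div 2 ^ t' = a div 2 ^ t div 2 ^ (t' - t)" for a :: int
    using assms(1) by (simp add: zdiv_zmult2_eq[symmetric] power_add[symmetric])
  with assms(2) show ?thesis by (simp add: grid_label_eq_iff)
qed

lemma in_cell_iff:
  assumes "p \<in> lattice d" "c \<in> lattice d"
  shows "p \<in> cell d s t c \<longleftrightarrow> grid_label d s t p = c"
proof -
  have *: "p \<in> cell d s t (grid_label d s t p)"
  proof -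
    have "s m + 2 ^ t * ((p m - s m) div 2 ^ t) \<le> p m \<and> p m < s m + 2 ^ t * ((p m - s m) div 2 ^ t + 1)" for m
    proof -
      have "p m - s m = 2 ^ t * ((p m - s m) div 2 ^ t) + (p m - s m) mod 2 ^ t" by simp
      moreover have "0 \<le> (p m - s m) mod 2 ^ t" "(p m - s m) mod 2 ^ t < 2 ^ t" by auto
      moreover have "2 ^ t * ((p m - s m) div 2 ^ t + 1) = 2 ^ t * ((p m - s m) div 2 ^ t) + 2 ^ t"
        by (simp add: algebra_simps)
      ultimately show ?thesis by linarith
    qed
    then show ?thesis using assms by (simp add: cell_def grid_label_def)
  qed
  show ?thesis
    using cell_unique[OF _ * assms(2) grid_label_in_lattice] * by blast
qed

text \<open>Only cells that meet the cube count, and these correspond one to one to the labels of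
  points of the cube.\<close>

lemma grid_norm_eq_level_norm:
  "grid_norm d l s v = level_norm (cube d (2 ^ l)) l (grid_label d s) v"
proof -
  let ?S = "cube d (2 ^ l)"
  let ?I = "SIGMA t:{..l}. grid_label d s t ` ?S"
  let ?h = "\<lambda>(t, c). (t, cell d s t c)"
  have lat: "p \<in> lattice d" if "p \<in> ?S" for p using that cube_subset_lattice by blast
  have meet: "?S \<inter> cell d s t c = {p \<in> ?S. grid_label d s t p = c}" if "c \<in> lattice d" for t c
    using in_cell_iff[OF lat that] by blast
  have J: "{(t, Q) \<in> grid_index d l s. ?S \<inter> Q \<noteq> {}} = ?h ` ?I"
  proof (intro equalityI subsetI)
    fix z assume "z \<in> {(t, Q) \<in> grid_index d l s. ?S \<inter> Q \<noteq> {}}"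
    then obtain t c where z: "z = (t, cell d s t c)" and t: "t \<le> l" and c: "c \<in> lattice d"
      and ne: "?S \<inter> cell d s t c \<noteq> {}"
      by (auto simp: grid_index_def grid_def)
    have "(t, c) \<in> ?I" using t ne unfolding meet[OF c] by auto
    with z show "z \<in> ?h ` ?I" by force
  next
    fix z assume "z \<in> ?h ` ?I"
    then obtain t p where z: "z = (t, cell d s t (grid_label d s t p))" and t: "t \<le> l" and p: "p \<in> ?S"
      by auto
    have "p \<in> ?S \<inter> cell d s t (grid_label d s t p)"
      unfolding meet[OF grid_label_in_lattice] using p by simp
    then show "z \<in> {(t, Q) \<in> grid_index d l s. ?S \<inter> Q \<noteq> {}}"
      using z t grid_label_in_lattice by (auto simp: grid_index_def grid_def)
  qed
  have "inj_on ?h ?I"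
  proof (rule inj_onI)
    fix a b assume a: "a \<in> ?I" and b: "b \<in> ?I" and eq: "?h a = ?h b"
    from a obtain t p where a': "a = (t, grid_label d s t p)" "p \<in> ?S" by auto
    from b obtain u q where b': "b = (u, grid_label d s u q)" "q \<in> ?S" by auto
    have tu: "u = t" and "cell d s t (grid_label d s t p) = cell d s t (grid_label d s t q)"
      using eq a' b' by auto
    \<comment> \<open>Each cell considered contains a point of the cube, and a common point of two
      cells determines both labels.\<close>
    then have "p \<in> cell d s t (grid_label d s t q)"
      using in_cell_iff[OF lat[OF a'(2)] grid_label_in_lattice] by blast
    then show "a = b"
      using in_cell_iff[OF lat[OF a'(2)] grid_label_in_lattice] a' b' tu by simp
  qed
  then have "grid_norm d l s v = (\<Sum>z\<in>?I. \<bar>grid_vec d l v (?h z)\<bar>)"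
    unfolding grid_norm_finite_sum J by (simp add: sum.reindex)
  also have "\<dots> = (\<Sum>(t, c)\<in>?I. 2 ^ t * \<bar>\<Sum>p\<in>{p\<in>?S. grid_label d s t p = c}. v p\<bar>)"
    using grid_label_in_lattice
    by (intro sum.cong refl) (auto simp: grid_vec_def cell_mass_def meet abs_mult)
  also have "\<dots> = level_norm ?S l (grid_label d s) v"
    unfolding level_norm_def using finite_cube by (subst sum.Sigma[symmetric]) (auto simp: sum_distrib_left)
  finally show ?thesis .
qed

lemma dist2_nonneg: "0 \<le> dist2 d p q"
  by (simp add: dist2_def)

section \<open>Comparison of the Euclidean distance with the tree distance\<close>

text \<open>The Cauchy-Schwarz inequality against the constant vector 1.\<close>

lemma sum_abs_le_dist2: "(\<Sum>m<d. real_of_int \<bar>p m - q m\<bar>) \<le> sqrt (real d) * dist2 d p q"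
proof -
  have "(\<Sum>m<d. \<bar>1::real\<bar> * \<bar>real_of_int (p m - q m)\<bar>)
      \<le> L2_set (\<lambda>_. 1) {..<d} * L2_set (\<lambda>m. real_of_int (p m - q m)) {..<d}"
    by (rule L2_set_mult_ineq)
  moreover have "L2_set (\<lambda>_. 1) {..<d} = sqrt (real d)" by (simp add: L2_set_def)
  ultimately show ?thesis by (simp add: dist2_def)
qed

lemma abs_diff_le_dist2:
  assumes "m < d"
  shows "real_of_int \<bar>p m - q m\<bar> \<le> dist2 d p q"
  using member_le_L2_set[of "{..<d}" m "\<lambda>m. \<bar>real_of_int (p m - q m)\<bar>"] assms
  by (simp add: dist2_def L2_set_def)

text \<open>If \<open>t\<close> is the coarsest separating level, the tree distance is at least
  \<open>2 ^ t\<close>, while every coordinate differs by at most \<open>2 * 2 ^ t\<close>: either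
  level \<open>t + 1\<close> puts both points into one cell, or \<open>t = l\<close> and the cube
  itself has side \<open>2 ^ l\<close>.\<close>

lemma dist2_le_tree_dist:
  assumes i: "i \<in> cube d (2 ^ l)" and j: "j \<in> cube d (2 ^ l)"
  shows "dist2 d i j \<le> 2 * sqrt (real d) * tree_dist l (grid_label d s) i j"
proof -
  define T where "T = {t. t \<le> l \<and> grid_label d s t i \<noteq> grid_label d s t j}"
  have T: "finite T" by (simp add: T_def)
  show ?thesis
  proof (cases "T = {}")
    case True
    \<comment> \<open>Cells of level 0 are single lattice points.\<close>
    then have "grid_label d s 0 i = grid_label d s 0 j" by (auto simp: T_def)
    then have "dist2 d i j = 0" by (simp add: grid_label_eq_iff dist2_def L2_set_def)
    then show ?thesis by (simp add: tree_dist_nonneg)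
  next
    case False
    define t where "t = Max T"
    have t: "t \<in> T" unfolding t_def using T False by simp
    have above: "u \<notin> T" if "u > t" for u using that Max_ge[OF T, of u] by (auto simp: t_def)
    have "2 ^ t * of_bool (grid_label d s t i \<noteq> grid_label d s t j) \<le> tree_dist l (grid_label d s) i j"
      unfolding tree_dist_def using t by (intro member_le_sum) (auto simp: T_def)
    then have tree: "2 ^ t \<le> tree_dist l (grid_label d s) i j" using t by (simp add: T_def)
    have diff: "\<bar>i m - j m\<bar> \<le> 2 * 2 ^ t" if m: "m < d" for m
    proof (cases "t = l")
      case True
      have "i m \<in> {1..2 ^ l}" "j m \<in> {1..2 ^ l}" using i j m by (auto simp: cube_def PiE_iff)
      then show ?thesis using True by auto
    next
      case False
      then have "Suc t \<le> l" using t by (auto simp: T_def)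
      then have "grid_label d s (Suc t) i = grid_label d s (Suc t) j"
        using above[of "Suc t"] by (auto simp: T_def)
      then have q: "(i m - s m) div 2 ^ Suc t = (j m - s m) div 2 ^ Suc t"
        using m by (simp add: grid_label_eq_iff)
      have "i m - s m = 2 ^ Suc t * ((i m - s m) div 2 ^ Suc t) + (i m - s m) mod 2 ^ Suc t"
        "j m - s m = 2 ^ Suc t * ((i m - s m) div 2 ^ Suc t) + (j m - s m) mod 2 ^ Suc t"
        by (simp, simp only: q mult_div_mod_eq)
      moreover have "0 \<le> (i m - s m) mod 2 ^ Suc t" "(i m - s m) mod 2 ^ Suc t < 2 ^ Suc t"
        "0 \<le> (j m - s m) mod 2 ^ Suc t" "(j m - s m) mod 2 ^ Suc t < 2 ^ Suc t"
        by (intro pos_mod_sign pos_mod_bound zero_less_power; simp)+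
      ultimately have "\<bar>i m - j m\<bar> \<le> 2 ^ Suc t" by linarith
      then show ?thesis by simp
    qed
    have "dist2 d i j = L2_set (\<lambda>m. real_of_int \<bar>i m - j m\<bar>) {..<d}"
      by (simp add: dist2_def L2_set_def)
    also have "\<dots> \<le> L2_set (\<lambda>m. 2 * 2 ^ t) {..<d}"
    proof (rule L2_set_mono)
      fix m assume "m \<in> {..<d}"
      then have "real_of_int \<bar>i m - j m\<bar> \<le> real_of_int (2 * 2 ^ t)"
        using diff by (intro of_int_le_iff[THEN iffD2]) auto
      then show "real_of_int \<bar>i m - j m\<bar> \<le> 2 * 2 ^ t" by simp
    qed simp
    also have "\<dots> = 2 * sqrt (real d) * 2 ^ t"
      by (simp add: L2_set_def real_sqrt_mult)
    also have "\<dots> \<le> 2 * sqrt (real d) * tree_dist l (grid_label d s) i j"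
      using tree by (intro mult_left_mono) auto
    finally show ?thesis .
  qed
qed

section \<open>Couplings and upper bounds for the earth mover distance\<close>

definition cost :: "nat \<Rightarrow> nat \<Rightarrow> ((nat \<Rightarrow> int) \<Rightarrow> (nat \<Rightarrow> int) \<Rightarrow> real) \<Rightarrow> real" where
  "cost d \<Delta> f = (\<Sum>i\<in>cube d \<Delta>. \<Sum>j\<in>cube d \<Delta>. f i j * dist2 d i j)"

lemma cost_nonneg:
  assumes "f \<in> couplings d \<Delta> x y"
  shows "0 \<le> cost d \<Delta> f"
  using assms by (auto simp: cost_def couplings_def dist2_nonneg intro!: sum_nonneg)

lemma emd_balanced_le_cost:
  assumes "f \<in> couplings d \<Delta> x y"
  shows "emd_balanced d \<Delta> x y \<le> cost d \<Delta> f"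
  unfolding emd_balanced_def cost_def[symmetric]
  using assms by (intro cINF_lower bdd_belowI2[of _ 0]) (auto intro: cost_nonneg)

text \<open>Marginals that lie below \<open>x\<close> and \<open>y\<close> but have the same totals
  leave no slack in any entry.\<close>

lemma partial_coupling_complete:
  assumes f: "\<And>i j. 0 \<le> f i j" "\<And>i. i \<in> cube d \<Delta> \<Longrightarrow> (\<Sum>j\<in>cube d \<Delta>. f i j) \<le> x i"
      "\<And>j. j \<in> cube d \<Delta> \<Longrightarrow> (\<Sum>i\<in>cube d \<Delta>. f i j) \<le> y j"
    and mass: "(\<Sum>i\<in>cube d \<Delta>. \<Sum>j\<in>cube d \<Delta>. f i j) = sum x (cube d \<Delta>)"
      "(\<Sum>i\<in>cube d \<Delta>. \<Sum>j\<in>cube d \<Delta>. f i j) = sum y (cube d \<Delta>)"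
  shows "f \<in> couplings d \<Delta> x y"
proof -
  have "(\<Sum>j\<in>cube d \<Delta>. f i j) = x i" if "i \<in> cube d \<Delta>" for i
    using sum_mono_inv[OF mass(1) f(2) that finite_cube] .
  moreover have "(\<Sum>j\<in>cube d \<Delta>. \<Sum>i\<in>cube d \<Delta>. f i j) = sum y (cube d \<Delta>)"
    using mass(2) by (subst sum.swap)
  then have "(\<Sum>i\<in>cube d \<Delta>. f i j) = y j" if "j \<in> cube d \<Delta>" for j
    using sum_mono_inv[of "\<lambda>j. \<Sum>i\<in>cube d \<Delta>. f i j" "cube d \<Delta>" y, OF _ f(3) that finite_cube]
    by blast
  ultimately show ?thesis using f(1) by (auto simp: couplings_def)
qed

text \<open>Needed because an infimum over an empty set of reals carries no information. With a
  single label for all points, the greedy construction just produces a flow with the right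
  marginals.\<close>

lemma couplings_nonempty:
  assumes "nonneg_on (cube d \<Delta>) x" "nonneg_on (cube d \<Delta>) y" "sum x (cube d \<Delta>) = sum y (cube d \<Delta>)"
  shows "couplings d \<Delta> x y \<noteq> {}"
proof -
  obtain f :: "(nat \<Rightarrow> int) \<Rightarrow> (nat \<Rightarrow> int) \<Rightarrow> real"
    where "\<And>i j. 0 \<le> f i j" "\<And>i. i \<in> cube d \<Delta> \<Longrightarrow> (\<Sum>j\<in>cube d \<Delta>. f i j) \<le> x i"
      "\<And>j. j \<in> cube d \<Delta> \<Longrightarrow> (\<Sum>i\<in>cube d \<Delta>. f i j) \<le> y j"
      "(\<Sum>i\<in>cube d \<Delta>. \<Sum>j\<in>cube d \<Delta>. f i j) = min (sum x (cube d \<Delta>)) (sum y (cube d \<Delta>))"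
    by (rule greedy_partial_coupling[OF finite_cube, of d \<Delta> "\<lambda>_ _. ()" x y])
      (use assms in \<open>auto simp: nonneg_on_def\<close>)
  then have "f \<in> couplings d \<Delta> x y"
    using assms(3) by (intro partial_coupling_complete) auto
  then show ?thesis by blast
qed

lemma l1_norm_nonneg_on:
  assumes "nonneg_on (cube d \<Delta>) x"
  shows "l1_norm (cube d \<Delta>) x = sum x (cube d \<Delta>)"
  using assms by (auto simp: l1_norm_finite finite_cube nonneg_on_def)

lemma emd_balanced_nonneg:
  assumes "nonneg_on (cube d \<Delta>) x" "nonneg_on (cube d \<Delta>) y" "sum x (cube d \<Delta>) = sum y (cube d \<Delta>)"
  shows "0 \<le> emd_balanced d \<Delta> x y"
  unfolding emd_balanced_def cost_def[symmetric]
  using couplings_nonempty[OF assms] by (intro cINF_greatest) (auto intro: cost_nonneg)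

text \<open>The marginals of \<open>f\<close> are admissible as \<open>x'\<close> and
  \<open>y'\<close> in the definition of \<open>emd\<close>. Since \<open>f\<close> carries the
  smaller of the two totals, one remainder has mass 0 and the other has the difference of the
  totals.\<close>

lemma emd_le_partial_cost:
  assumes x: "nonneg_on (cube d \<Delta>) x" and y: "nonneg_on (cube d \<Delta>) y"
    and f: "\<And>i j. 0 \<le> f i j" "\<And>i. i \<in> cube d \<Delta> \<Longrightarrow> (\<Sum>j\<in>cube d \<Delta>. f i j) \<le> x i"
      "\<And>j. j \<in> cube d \<Delta> \<Longrightarrow> (\<Sum>i\<in>cube d \<Delta>. f i j) \<le> y j"
    and mass: "(\<Sum>i\<in>cube d \<Delta>. \<Sum>j\<in>cube d \<Delta>. f i j) = min (sum x (cube d \<Delta>)) (sum y (cube d \<Delta>))"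
  shows "emd d \<Delta> x y
    \<le> cost d \<Delta> f + real d * real \<Delta> * \<bar>sum x (cube d \<Delta>) - sum y (cube d \<Delta>)\<bar>"
proof (cases "sum x (cube d \<Delta>) = sum y (cube d \<Delta>)")
  case True
  then have "f \<in> couplings d \<Delta> x y"
    using f mass by (intro partial_coupling_complete) auto
  then show ?thesis
    using True x y emd_balanced_le_cost[of f d \<Delta> x y] by (simp add: emd_def l1_norm_nonneg_on)
next
  case False
  let ?S = "cube d \<Delta>"
  let ?pen = "\<lambda>x' y'. real d * real \<Delta> * (l1_norm ?S (x - x') + l1_norm ?S (y - y'))"
  let ?A = "{emd_balanced d \<Delta> x' y' + ?pen x' y' | x' y'.
    (\<forall>i\<in>?S. 0 \<le> x' i \<and> x' i \<le> x i) \<and> (\<forall>i\<in>?S. 0 \<le> y' i \<and> y' i \<le> y i) \<and> l1_norm ?S x' = l1_norm ?S y'}"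
  define x' where "x' i = (\<Sum>j\<in>?S. f i j)" for i
  define y' where "y' j = (\<Sum>i\<in>?S. f i j)" for j
  have nonneg: "nonneg_on ?S x'" "nonneg_on ?S y'" "nonneg_on ?S (x - x')" "nonneg_on ?S (y - y')"
    using f by (auto simp: nonneg_on_def x'_def y'_def intro: sum_nonneg)
  have "sum y' ?S = (\<Sum>i\<in>?S. \<Sum>j\<in>?S. f i j)" unfolding y'_def by (rule sum.swap)
  then have sums: "sum x' ?S = min (sum x ?S) (sum y ?S)" "sum y' ?S = min (sum x ?S) (sum y ?S)"
    using mass by (auto simp: x'_def)
  have "emd d \<Delta> x y = Inf ?A"
    using False x y by (simp add: emd_def l1_norm_nonneg_on)
  also have "\<dots> \<le> emd_balanced d \<Delta> x' y' + ?pen x' y'"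
  proof (rule cInf_lower)
    show "emd_balanced d \<Delta> x' y' + ?pen x' y' \<in> ?A"
    proof (rule CollectI, rule exI[of _ x'], rule exI[of _ y'], intro conjI refl)
      show "\<forall>i\<in>?S. 0 \<le> x' i \<and> x' i \<le> x i" "\<forall>i\<in>?S. 0 \<le> y' i \<and> y' i \<le> y i"
        using nonneg by (auto simp: nonneg_on_def)
      show "l1_norm ?S x' = l1_norm ?S y'"
        using nonneg sums by (simp add: l1_norm_nonneg_on)
    qed
    show "bdd_below ?A"
    proof (rule bdd_belowI[of _ 0])
      fix r assume "r \<in> ?A"
      then obtain u w where r: "r = emd_balanced d \<Delta> u w + ?pen u w"
        and uw: "nonneg_on ?S u" "nonneg_on ?S w" "l1_norm ?S u = l1_norm ?S w"
        by (auto simp: nonneg_on_def)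
      have "0 \<le> emd_balanced d \<Delta> u w"
        using uw by (intro emd_balanced_nonneg) (auto simp: l1_norm_nonneg_on)
      moreover have "0 \<le> ?pen u w"
        by (simp add: l1_norm_finite finite_cube sum_nonneg)
      ultimately show "0 \<le> r" using r by simp
    qed
  qed
  also have "emd_balanced d \<Delta> x' y' \<le> cost d \<Delta> f"
    using f(1) by (intro emd_balanced_le_cost) (auto simp: couplings_def x'_def y'_def)
  also have "l1_norm ?S (x - x') + l1_norm ?S (y - y') = \<bar>sum x ?S - sum y ?S\<bar>"
    using nonneg sums by (simp add: l1_norm_nonneg_on sum_subtractf min_def)
  finally show ?thesis by simp
qed

lemma pos_minus_neg_part: "pos_part v - neg_part v = v"
  by (simp add: neg_part_def fun_eq_iff)

lemma nonneg_on_parts: "nonneg_on S (pos_part v)" "nonneg_on S (neg_part v)"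
  by (auto simp: nonneg_on_def pos_part_def neg_part_def)

lemma sum_parts: "sum (pos_part v) S - sum (neg_part v) S = sum v S"
proof -
  have "sum (pos_part v) S - sum (neg_part v) S = sum (pos_part v - neg_part v) S"
    by (simp add: sum_subtractf)
  then show ?thesis by (simp only: pos_minus_neg_part)
qed

text \<open>The greedy coupling for the tree of \<open>s\<close> is charged at Euclidean cost. The
  factor 2 of \<open>dist2_le_tree_dist\<close> is used up by the factor 2 in the greedy bound,
  which leaves the constant 1.\<close>

lemma emd_norm_le_grid_norm:
  "emd_norm d (2 ^ l) v
    \<le> sqrt (real d) * grid_norm d l s v + real d * real (2 ^ l) * \<bar>sum v (cube d (2 ^ l))\<bar>"
proof -
  let ?S = "cube d (2 ^ l)"
  let ?tree = "tree_dist l (grid_label d s)"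
  obtain f :: "(nat \<Rightarrow> int) \<Rightarrow> (nat \<Rightarrow> int) \<Rightarrow> real"
    where f: "\<And>i j. 0 \<le> f i j" "\<And>i. i \<in> ?S \<Longrightarrow> (\<Sum>j\<in>?S. f i j) \<le> pos_part v i"
      "\<And>j. j \<in> ?S \<Longrightarrow> (\<Sum>i\<in>?S. f i j) \<le> neg_part v j"
      "(\<Sum>i\<in>?S. \<Sum>j\<in>?S. f i j) = min (sum (pos_part v) ?S) (sum (neg_part v) ?S)"
      "2 * (\<Sum>i\<in>?S. \<Sum>j\<in>?S. f i j * ?tree i j) \<le> level_norm ?S l (grid_label d s) (pos_part v - neg_part v)"
    by (rule greedy_partial_coupling[OF finite_cube, of d "2 ^ l" "grid_label d s" "pos_part v" "neg_part v" l])
      (use nonneg_on_parts[of ?S v] in \<open>auto simp: nonneg_on_def intro: grid_label_nested\<close>)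
  have "cost d (2 ^ l) f \<le> (\<Sum>i\<in>?S. \<Sum>j\<in>?S. f i j * (2 * sqrt (real d) * ?tree i j))"
    unfolding cost_def using f(1) by (intro sum_mono mult_left_mono dist2_le_tree_dist)
  also have "\<dots> = sqrt (real d) * (2 * (\<Sum>i\<in>?S. \<Sum>j\<in>?S. f i j * ?tree i j))"
    by (simp add: sum_distrib_left mult_ac)
  also have "\<dots> \<le> sqrt (real d) * grid_norm d l s v"
    using f(5) by (intro mult_left_mono) (auto simp: pos_minus_neg_part grid_norm_eq_level_norm)
  finally have "cost d (2 ^ l) f \<le> sqrt (real d) * grid_norm d l s v" .
  moreover have "emd_norm d (2 ^ l) v
      \<le> cost d (2 ^ l) f + real d * real (2 ^ l) * \<bar>sum (pos_part v) ?S - sum (neg_part v) ?S\<bar>"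
    unfolding emd_norm_def by (intro emd_le_partial_cost nonneg_on_parts f(1-4))
  ultimately show ?thesis by (simp add: sum_parts)
qed

section \<open>Random shifts\<close>

lemma cube_nonempty:
  assumes "\<Delta> > 0"
  shows "cube d \<Delta> \<noteq> {}"
  using assms by (auto simp: cube_def PiE_eq_empty_iff)

text \<open>A coordinate of a uniform point of a product is uniform: the other coordinates
  contribute the factor \<open>\<Delta> ^ (d - 1)\<close> to both counts.\<close>

lemma prob_coordinate:
  assumes m: "m < d" and \<Delta>: "\<Delta> > 0"
  shows "measure_pmf.prob (pmf_of_set (cube d \<Delta>)) {s. P (s m)} = card {a\<in>{1..int \<Delta>}. P a} / \<Delta>"
proof -
  have "(\<forall>i\<in>{..<d}. s i \<in> A) \<and> P (s m) \<longleftrightarrow> (\<forall>i\<in>{..<d}. s i \<in> (if i = m then {a\<in>A. P a} else A))"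
    for s and A :: "int set"
    using m by auto
  then have "cube d \<Delta> \<inter> {s. P (s m)}
      = (\<Pi>\<^sub>E i\<in>{..<d}. if i = m then {a\<in>{1..int \<Delta>}. P a} else {1..int \<Delta>})"
    unfolding cube_def set_eq_iff Int_iff mem_Collect_eq PiE_iff by blast
  then have "card (cube d \<Delta> \<inter> {s. P (s m)})
      = (\<Prod>i<d. card (if i = m then {a\<in>{1..int \<Delta>}. P a} else {1..int \<Delta>}))"
    by (simp only: card_PiE finite_lessThan)
  also have "\<dots> = card {a\<in>{1..int \<Delta>}. P a} * (\<Prod>i\<in>{..<d} - {m}. \<Delta>)"
    using m by (subst prod.remove[of _ m]) (auto intro!: prod.cong)
  finally have "card (cube d \<Delta> \<inter> {s. P (s m)}) = card {a\<in>{1..int \<Delta>}. P a} * \<Delta> ^ (d - 1)"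
    using m by simp
  moreover have "card (cube d \<Delta>) = \<Delta> * \<Delta> ^ (d - 1)"
    using m by (simp add: cube_def card_PiE flip: power_Suc)
  ultimately show ?thesis
    using \<Delta> by (simp add: measure_pmf_of_set finite_cube cube_nonempty)
qed

lemma int_div_less_iff:
  fixes x T n :: int
  assumes "T > 0"
  shows "x div T < n \<longleftrightarrow> x < T * n"
proof -
  have x: "T * (x div T) + x mod T = x" "0 \<le> x mod T" "x mod T < T" using assms by auto
  have "T * n \<le> T * (x div T)" if "n \<le> x div T" using that assms by simp
  moreover have "T * (x div T + 1) \<le> T * n" if "x div T < n" using that assms by (intro mult_left_mono) auto
  moreover have "T * (x div T + 1) = T * (x div T) + T" by (simp add: distrib_left)
  ultimately show ?thesis using x by linarith
qed

text \<open>The interval splits into \<open>2 ^ (l - t)\<close> blocks of \<open>2 ^ t\<close>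
  consecutive integers, and a block contains at most one member of a residue class.\<close>

lemma card_residue_class_le:
  assumes "t \<le> l"
  shows "real (card {a\<in>{1..(2::int) ^ l}. 2 ^ t dvd c - a}) \<le> 2 ^ l / 2 ^ t"
proof -
  let ?A = "{a\<in>{1..(2::int) ^ l}. 2 ^ t dvd c - a}"
  have pow: "(2::int) ^ l = 2 ^ t * 2 ^ (l - t)" using assms by (simp flip: power_add)
  have "inj_on (\<lambda>a. (a - 1) div 2 ^ t) ?A"
  proof (rule inj_onI)
    fix a b assume a: "a \<in> ?A" and b: "b \<in> ?A" and eq: "(a - 1) div 2 ^ t = (b - 1) div 2 ^ t"
    have "2 ^ t dvd c - b" "2 ^ t dvd c - a" using a b by auto
    then have "2 ^ t dvd (c - b) - (c - a)" by (rule dvd_diff)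
    then have "2 ^ t dvd (a - 1) - (b - 1)" by simp
    then have "(a - 1) mod 2 ^ t = (b - 1) mod 2 ^ t" by (simp only: mod_eq_dvd_iff)
    with eq have "a - 1 = b - 1" by (metis mult_div_mod_eq)
    then show "a = b" by simp
  qed
  moreover have "(\<lambda>a. (a - 1) div 2 ^ t) ` ?A \<subseteq> {0..<2 ^ (l - t)}"
  proof (rule image_subsetI)
    fix a assume "a \<in> ?A"
    then have a: "0 \<le> a - 1" "a - 1 < 2 ^ t * 2 ^ (l - t)"
      using pow by auto
    have "(a - 1) div 2 ^ t < 2 ^ (l - t)"
      using a(2) by (simp add: int_div_less_iff)
    moreover have "0 \<le> (a - 1) div 2 ^ t" using a(1) by (simp add: pos_imp_zdiv_nonneg_iff)
    ultimately show "(a - 1) div 2 ^ t \<in> {0..<2 ^ (l - t)}" by simp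
  qed
  ultimately have "card ?A \<le> card {0..<(2::int) ^ (l - t)}"
    by (intro card_inj_on_le) auto
  then have "card ?A \<le> 2 ^ (l - t)" by (simp add: nat_power_eq)
  then have "real (card ?A) \<le> real (2 ^ (l - t))" by (simp only: of_nat_le_iff)
  then have "real (card ?A) \<le> 2 ^ (l - t)" by simp
  also have "(2::real) ^ (l - t) = 2 ^ l / 2 ^ t" using assms by (simp add: power_diff)
  finally show ?thesis .
qed

section \<open>Separation of points and nearness to cell walls\<close>

text \<open>\<open>2 ^ t dvd c - s m\<close> says that a cell of level \<open>t\<close> begins at
  \<open>c\<close> in direction \<open>m\<close>, so the wall lies between \<open>c - 1\<close> and
  \<open>c\<close>.\<close>

definition boundary_hit :: "nat \<Rightarrow> nat \<Rightarrow> (nat \<Rightarrow> int set) \<Rightarrow> (nat \<Rightarrow> int) \<Rightarrow> bool" where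
  "boundary_hit d t C s \<longleftrightarrow> (\<exists>m<d. \<exists>c\<in>C m. 2 ^ t dvd c - s m)"

text \<open>Union bound over coordinates and positions; a given position is a wall with probability
  at most \<open>1 / 2 ^ t\<close>.\<close>

lemma prob_boundary_hit_le:
  assumes t: "t \<le> l" and C: "\<And>m. finite (C m)"
  shows "measure_pmf.prob (pmf_of_set (cube d (2 ^ l))) {s. boundary_hit d t C s}
    \<le> (\<Sum>m<d. real (card (C m))) / 2 ^ t"
proof -
  let ?P = "measure_pmf.prob (pmf_of_set (cube d (2 ^ l)))"
  have single: "?P {s. 2 ^ t dvd c - s m} \<le> 1 / 2 ^ t" if "m < d" for c m
    using card_residue_class_le[OF t, of c]
    by (subst prob_coordinate[OF that]) (auto simp: divide_simps)
  have "?P {s. boundary_hit d t C s} = ?P (\<Union>m\<in>{..<d}. \<Union>c\<in>C m. {s. 2 ^ t dvd c - s m})"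
    by (rule arg_cong[of _ _ ?P]) (auto simp: boundary_hit_def)
  also have "\<dots> \<le> (\<Sum>m<d. ?P (\<Union>c\<in>C m. {s. 2 ^ t dvd c - s m}))"
    by (rule measure_UNION_le) auto
  also have "\<dots> \<le> (\<Sum>m<d. \<Sum>c\<in>C m. ?P {s. 2 ^ t dvd c - s m})"
    using C by (intro sum_mono measure_UNION_le) auto
  also have "\<dots> \<le> (\<Sum>m<d. \<Sum>c\<in>C m. 1 / 2 ^ t)"
    using single by (intro sum_mono) auto
  finally show ?thesis by (simp add: sum_divide_distrib)
qed

text \<open>In a coordinate where the quotients differ, the cell of the larger value begins above
  the smaller value and not above the larger one. Hence the interval is open on the left
  only.\<close>

lemma separated_imp_boundary_hit:
  assumes "grid_label d s t i \<noteq> grid_label d s t j"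
  shows "boundary_hit d t (\<lambda>m. {min (i m) (j m)<..max (i m) (j m)}) s"
proof -
  obtain m where m: "m < d" "(i m - s m) div 2 ^ t \<noteq> (j m - s m) div 2 ^ t"
    using assms by (auto simp: grid_label_eq_iff)
  have "\<exists>c\<in>{a<..b}. 2 ^ t dvd c - s m" if "(a - s m) div 2 ^ t < (b - s m) div 2 ^ t" for a b
  proof (intro bexI)
    define q where "q = (b - s m) div 2 ^ t"
    have "2 ^ t * q \<le> b - s m"
      using mult_div_mod_eq[of "2 ^ t" "b - s m"] pos_mod_sign[of "2 ^ t" "b - s m", OF zero_less_power]
      unfolding q_def by linarith
    moreover have "a - s m < 2 ^ t * q"
      using that by (simp add: int_div_less_iff flip: q_def)
    ultimately show "s m + 2 ^ t * q \<in> {a<..b}" by simp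
  qed simp
  then have "\<exists>c\<in>{i m<..j m} \<union> {j m<..i m}. 2 ^ t dvd c - s m"
    using m(2) by (meson UnI1 UnI2 linorder_neqE)
  moreover have "{i m<..j m} \<union> {j m<..i m} \<subseteq> {min (i m) (j m)<..max (i m) (j m)}" by auto
  ultimately show ?thesis using m(1) unfolding boundary_hit_def by blast
qed

text \<open>Coordinate \<open>m\<close> offers \<open>\<bar>i m - j m\<bar>\<close> wall positions,
  so the union bound yields the l1 distance of the points.\<close>

lemma prob_separated_le:
  assumes "t \<le> l"
  shows "measure_pmf.prob (pmf_of_set (cube d (2 ^ l))) {s. grid_label d s t i \<noteq> grid_label d s t j}
    \<le> sqrt (real d) * dist2 d i j / 2 ^ t"
proof -
  let ?P = "measure_pmf.prob (pmf_of_set (cube d (2 ^ l)))"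
  let ?C = "\<lambda>m. {min (i m) (j m)<..max (i m) (j m)}"
  have "?P {s. grid_label d s t i \<noteq> grid_label d s t j} \<le> ?P {s. boundary_hit d t ?C s}"
    by (rule measure_pmf.finite_measure_mono) (auto intro: separated_imp_boundary_hit)
  also have "\<dots> \<le> (\<Sum>m<d. real (card (?C m))) / 2 ^ t"
    using assms by (intro prob_boundary_hit_le) auto
  also have "(\<Sum>m<d. real (card (?C m))) = (\<Sum>m<d. real_of_int \<bar>i m - j m\<bar>)"
    by (intro sum.cong) (auto simp: min_def max_def)
  also have "\<dots> \<le> sqrt (real d) * dist2 d i j" by (rule sum_abs_le_dist2)
  finally show ?thesis by (simp add: divide_right_mono)
qed

text \<open>Being open on the left, the window contains the interval of
  \<open>separated_imp_boundary_hit\<close> for every \<open>j\<close> whose coordinates are within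
  the radius.\<close>

definition near_boundary :: "real \<Rightarrow> nat \<Rightarrow> nat \<Rightarrow> (nat \<Rightarrow> int) \<Rightarrow> (nat \<Rightarrow> int) \<Rightarrow> bool" where
  "near_boundary K d t i s
    \<longleftrightarrow> boundary_hit d t (\<lambda>m. {i m - \<lfloor>2 ^ t / K\<rfloor><..i m + \<lfloor>2 ^ t / K\<rfloor>}) s"

text \<open>The window grows like \<open>2 ^ t\<close> and the probability of each position shrinks
  like \<open>1 / 2 ^ t\<close>, so the bound is the same on every level.\<close>

lemma prob_near_boundary_le:
  assumes "t \<le> l" "K > 0"
  shows "measure_pmf.prob (pmf_of_set (cube d (2 ^ l))) {s. near_boundary K d t i s} \<le> 2 * real d / K"
proof -
  define r where "r = \<lfloor>2 ^ t / K\<rfloor>"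
  have r: "0 \<le> r" "real_of_int r \<le> 2 ^ t / K" using assms by (auto simp: r_def)
  have "measure_pmf.prob (pmf_of_set (cube d (2 ^ l))) {s. near_boundary K d t i s}
      \<le> (\<Sum>m<d. real (card {i m - r<..i m + r})) / 2 ^ t"
    unfolding near_boundary_def r_def[symmetric] using assms by (intro prob_boundary_hit_le) auto
  also have "\<dots> = real d * (2 * real_of_int r) / 2 ^ t" using r by simp
  also have "\<dots> \<le> real d * (2 * (2 ^ t / K)) / 2 ^ t"
    using r by (intro divide_right_mono mult_left_mono) auto
  finally show ?thesis by (simp add: mult.commute)
qed

lemma separated_imp_near_boundary:
  assumes sep: "grid_label d s t i \<noteq> grid_label d s t j" and near: "K * dist2 d i j < 2 ^ t" and K: "K > 0"
  shows "near_boundary K d t i s"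
proof -
  obtain m c where m: "m < d" and c: "min (i m) (j m) < c" "c \<le> max (i m) (j m)" "2 ^ t dvd c - s m"
    using separated_imp_boundary_hit[OF sep] by (auto simp: boundary_hit_def simp del: min_less_iff_conj max_less_iff_conj)
  have "dist2 d i j \<le> 2 ^ t / K" using near K by (simp add: pos_le_divide_eq mult.commute)
  then have "real_of_int \<bar>i m - j m\<bar> \<le> 2 ^ t / K"
    using abs_diff_le_dist2[OF m, of i j] by linarith
  \<comment> \<open>The difference is an integer, so rounding the radius down loses nothing.\<close>
  then have "\<bar>i m - j m\<bar> \<le> \<lfloor>2 ^ t / K\<rfloor>" by (simp add: le_floor_iff)
  then have "c \<in> {i m - \<lfloor>2 ^ t / K\<rfloor><..i m + \<lfloor>2 ^ t / K\<rfloor>}" using c by (auto simp: min_def max_def split: if_splits)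
  then show ?thesis using m c(3) unfolding near_boundary_def boundary_hit_def by blast
qed

section \<open>Summation over levels\<close>

text \<open>A geometric sum of powers of two is at most twice its largest term.\<close>

lemma sum_powers_le:
  fixes D :: real
  assumes "0 \<le> D"
  shows "(\<Sum>t | t \<le> l \<and> 2 ^ t \<le> D. 2 ^ t) \<le> 2 * D"
proof (cases "{t. t \<le> l \<and> 2 ^ t \<le> D} = {}")
  case False
  let ?T = "{t. t \<le> l \<and> 2 ^ t \<le> D}"
  have "Max ?T \<in> ?T" using False by (intro Max_in) auto
  then have M: "2 ^ Max ?T \<le> D" by simp
  have "(\<Sum>t\<in>?T. (2::real) ^ t) \<le> (\<Sum>t<Suc (Max ?T). 2 ^ t)"
    by (intro sum_mono2) (auto simp: less_Suc_eq_le)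
  also have "\<dots> \<le> 2 * 2 ^ Max ?T" by (subst geometric_sum) auto
  finally show ?thesis using M by simp
next
  case True
  show ?thesis unfolding True using assms by simp
qed

text \<open>The largest and the smallest of these powers have ratio at most \<open>K\<close>, so
  their exponents differ by at most \<open>log 2 K\<close>.\<close>

lemma card_powers_le:
  fixes D K :: real
  assumes "0 < D" "1 \<le> K"
  shows "real (card {t. t \<le> l \<and> D < 2 ^ t \<and> 2 ^ t \<le> K * D}) \<le> log 2 K + 1"
proof (cases "{t. t \<le> l \<and> D < 2 ^ t \<and> 2 ^ t \<le> K * D} = {}")
  case False
  let ?T = "{t. t \<le> l \<and> D < 2 ^ t \<and> 2 ^ t \<le> K * D}"
  have fin: "finite ?T" by auto
  have "Max ?T \<in> ?T" "Min ?T \<in> ?T" using False fin by (intro Max_in Min_in; simp)+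
  then have M: "2 ^ Max ?T \<le> K * D" "D < 2 ^ Min ?T" by auto
  have le: "Min ?T \<le> Max ?T" using False fin by (meson Max_in Min_le)
  have "K * D \<le> K * 2 ^ Min ?T" using M assms by (intro mult_left_mono) auto
  then have "(2::real) ^ (Max ?T - Min ?T) \<le> K"
    using M le by (simp add: power_diff divide_simps)
  then have "real (Max ?T - Min ?T) \<le> log 2 K"
    using assms by (simp add: le_log_iff powr_realpow)
  moreover have "card ?T \<le> card {Min ?T..Max ?T}" by (intro card_mono) auto
  ultimately show ?thesis using le by (simp add: of_nat_diff)
next
  case True
  show ?thesis unfolding True using assms by simp
qed

text \<open>Levels with \<open>2 ^ t \<le> D\<close> use \<open>p t \<le> 1\<close> and form a
  geometric sum. On the others \<open>p t \<le> a / 2 ^ t\<close> makes each term at most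
  \<open>a\<close>, and there are at most \<open>log 2 K + 1\<close> of them.\<close>

lemma weighted_levels_le:
  fixes D K a :: real
  assumes D: "0 \<le> D" and K: "1 \<le> K" and a: "0 \<le> a"
    and p: "\<And>t. t \<le> l \<Longrightarrow> p t \<le> 1" "\<And>t. t \<le> l \<Longrightarrow> p t \<le> a / 2 ^ t"
  shows "(\<Sum>t | t \<le> l \<and> 2 ^ t \<le> K * D. 2 ^ t * p t) \<le> 2 * D + a * (log 2 K + 1)"
proof (cases "D = 0")
  case True
  then have "{t. t \<le> l \<and> (2::real) ^ t \<le> K * D} = {}" by (simp add: not_le)
  moreover have "0 \<le> a * (log 2 K + 1)" using K a by simp
  ultimately show ?thesis using True by (simp only: sum.empty mult_zero_right add_0)
next
  case False
  then have D: "D > 0" using D by simp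
  have "D * 1 \<le> D * K" using D K by (intro mult_left_mono) auto
  then have split: "{t. t \<le> l \<and> 2 ^ t \<le> K * D}
      = {t. t \<le> l \<and> 2 ^ t \<le> D} \<union> {t. t \<le> l \<and> D < 2 ^ t \<and> 2 ^ t \<le> K * D}"
    by (auto simp: mult.commute)
  have "(\<Sum>t | t \<le> l \<and> 2 ^ t \<le> K * D. 2 ^ t * p t)
      = (\<Sum>t | t \<le> l \<and> 2 ^ t \<le> D. 2 ^ t * p t) + (\<Sum>t | t \<le> l \<and> D < 2 ^ t \<and> 2 ^ t \<le> K * D. 2 ^ t * p t)"
    unfolding split by (rule sum.union_disjoint) auto
  also have "\<dots> \<le> (\<Sum>t | t \<le> l \<and> 2 ^ t \<le> D. 2 ^ t) + (\<Sum>t | t \<le> l \<and> D < 2 ^ t \<and> 2 ^ t \<le> K * D. a)"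
    using p by (intro add_mono sum_mono) (auto simp: field_simps)
  also have "\<dots> \<le> 2 * D + (log 2 K + 1) * a"
    using sum_powers_le[of D l] card_powers_le[of D K l] D K a by (intro add_mono) (auto intro: mult_right_mono)
  finally show ?thesis by (simp add: mult.commute)
qed

text \<open>Since \<open>log 2 d \<le> 4 * sqrt d\<close>, the logarithm of the dimension inside
  \<open>K\<close> is absorbed by the step from \<open>sqrt d\<close> to \<open>d\<close>; constants
  are absorbed by \<open>M \<ge> 1\<close>.\<close>

lemma log_factor_le:
  assumes "d \<ge> 1" "k \<ge> 1"
  shows "2 + sqrt (real d) * (log 2 (4000 * real k * real d * (real l + 1)) + 1)
    \<le> 25 * real d * max 1 (log 2 (real k) + log 2 (log 2 (real (2 ^ l))))"
proof -
  define M where "M = max 1 (log 2 (real k) + log 2 (real l))"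
  have M: "1 \<le> M" "log 2 (real k) + log 2 (real l) \<le> M" by (auto simp: M_def)
  have "log 2 4000 \<le> log 2 (2 ^ 12 :: real)" by (subst log_le_cancel_iff) auto
  then have c: "log 2 4000 \<le> (12::real)" by (subst (asm) log_nat_power) auto
  have "log 2 (real l + 1) \<le> log 2 (real l) + 1"
  proof (cases "l = 0")
    case False
    then have "log 2 (real l + 1) \<le> log 2 (real l * 2)" by (subst log_le_cancel_iff) auto
    then show ?thesis using False by (simp add: log_mult)
  next
    case True
    \<comment> \<open>Here the convention \<open>log 2 0 = 0\<close> enters.\<close>
    then show ?thesis by (simp add: log_def)
  qed
  \<comment> \<open>The constants are 12 from the factor 4000, 1 from \<open>l + 1\<close> and the
    added 1; with the logarithms in \<open>M\<close> they stay below \<open>15 * M\<close>.\<close>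
  then have log: "log 2 (4000 * real k * real d * (real l + 1)) + 1 \<le> 15 * M + log 2 (real d)"
    using assms c M by (simp add: log_mult)
  have sqrt: "1 \<le> sqrt (real d)" "sqrt (real d) * sqrt (real d) = real d" using assms by auto
  have "ln (real d) = 2 * ln (sqrt (real d))" using assms by (simp add: ln_sqrt)
  also have "\<dots> \<le> 2 * sqrt (real d)" using ln_le_minus_one[of "sqrt (real d)"] sqrt by simp
  also have "\<dots> \<le> 4 * sqrt (real d) * ln 2"
    using ln2_ge_two_thirds sqrt by (simp add: mult_le_cancel_left)
  finally have "log 2 (real d) \<le> 4 * sqrt (real d)" by (simp add: log_def divide_simps)
  then have "sqrt (real d) * log 2 (real d) \<le> sqrt (real d) * (4 * sqrt (real d))"
    using sqrt by (intro mult_left_mono) auto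
  also have "\<dots> \<le> 4 * real d * M" using sqrt M assms by (simp add: mult.left_commute)
  finally have 1: "sqrt (real d) * log 2 (real d) \<le> 4 * real d * M" .
  have "sqrt (real d) * 1 \<le> sqrt (real d) * sqrt (real d)" using sqrt by (intro mult_left_mono) auto
  then have "sqrt (real d) \<le> real d" using sqrt by simp
  then have 2: "sqrt (real d) * (15 * M) \<le> real d * (15 * M)" using M by (intro mult_right_mono) auto
  have 3: "1 * 1 \<le> real d * M" using assms M by (intro mult_mono) auto
  have "sqrt (real d) * (log 2 (4000 * real k * real d * (real l + 1)) + 1)
      \<le> sqrt (real d) * (15 * M + log 2 (real d))"
    using log sqrt by (intro mult_left_mono) auto
  also have "\<dots> \<le> 19 * (real d * M)" using 1 2 by (simp add: distrib_left)
  finally have "2 + sqrt (real d) * (log 2 (4000 * real k * real d * (real l + 1)) + 1) \<le> 25 * (real d * M)"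
    using 3 by linarith
  moreover have "log 2 (real (2 ^ l)) = real l" by (simp add: log_nat_power)
  ultimately show ?thesis by (simp add: M_def)
qed

section \<open>Near-optimal couplings and the probability bound\<close>

text \<open>The two parts have disjoint supports, so no mass stays in place, and distinct lattice
  points are at distance at least 1.\<close>

lemma sum_pos_part_le_cost:
  assumes f: "f \<in> couplings d \<Delta> (pos_part v) (neg_part v)"
  shows "sum (pos_part v) (cube d \<Delta>) \<le> cost d \<Delta> f"
proof -
  let ?S = "cube d \<Delta>"
  have nonneg: "0 \<le> f i j" if "i \<in> ?S" "j \<in> ?S" for i j using f that by (simp add: couplings_def)
  have row: "(\<Sum>j\<in>?S. f i j) = pos_part v i" and col: "(\<Sum>j\<in>?S. f j i) = neg_part v i" if "i \<in> ?S" for i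
    using f that by (auto simp: couplings_def)
  have "f i j \<le> f i j * dist2 d i j" if ij: "i \<in> ?S" "j \<in> ?S" for i j
  proof (cases "i = j")
    case True
    have "f i i \<le> (\<Sum>j\<in>?S. f i j)" "f i i \<le> (\<Sum>j\<in>?S. f j i)"
      using ij nonneg finite_cube by (auto intro!: member_le_sum)
    then have "f i i \<le> pos_part v i" "f i i \<le> neg_part v i" using row col ij by auto
    then have "f i i \<le> 0" by (auto simp: pos_part_def neg_part_def)
    then show ?thesis using True nonneg[of i i] ij by simp
  next
    case False
    then obtain m where m: "m < d" "i m \<noteq> j m"
      using ij by (metis PiE_ext cube_def lessThan_iff)
    have "1 \<le> real_of_int \<bar>i m - j m\<bar>" using m(2) by simp
    then have "1 \<le> dist2 d i j" using abs_diff_le_dist2[OF m(1), of i j] by linarith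
    then show ?thesis using nonneg[OF ij] by (simp add: mult_le_cancel_left1)
  qed
  then have "(\<Sum>i\<in>?S. \<Sum>j\<in>?S. f i j) \<le> cost d \<Delta> f"
    unfolding cost_def by (intro sum_mono) auto
  then show ?thesis using row by simp
qed

text \<open>The transported mass bounds the infimum away from 0. Twice the infimum is then strictly
  larger than it, so some coupling costs less, and no minimizer has to be constructed.\<close>

lemma obtain_near_optimal_coupling:
  assumes v: "sum v (cube d \<Delta>) = 0" and p: "p \<in> cube d \<Delta>" "v p \<noteq> 0"
  obtains f where "f \<in> couplings d \<Delta> (pos_part v) (neg_part v)"
    "cost d \<Delta> f \<le> 2 * emd_norm d \<Delta> v" "0 < emd_norm d \<Delta> v"
proof -
  let ?S = "cube d \<Delta>"
  let ?F = "couplings d \<Delta> (pos_part v) (neg_part v)"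
  have bal: "sum (pos_part v) ?S = sum (neg_part v) ?S" using sum_parts[of v ?S] v by simp
  have F: "?F \<noteq> {}" by (rule couplings_nonempty[OF nonneg_on_parts bal])
  have emd: "emd_norm d \<Delta> v = (INF f\<in>?F. cost d \<Delta> f)"
    using bal by (simp add: emd_norm_def emd_def l1_norm_nonneg_on nonneg_on_parts emd_balanced_def cost_def)
  have "0 < sum (pos_part v) ?S"
  proof (rule ccontr)
    assume "\<not> 0 < sum (pos_part v) ?S"
    then have "sum (pos_part v) ?S = 0" "sum (neg_part v) ?S = 0"
      using bal sum_nonneg[of ?S "pos_part v"] nonneg_on_parts[of ?S v] by (auto simp: nonneg_on_def)
    then have "pos_part v p = 0" "neg_part v p = 0"
      using nonneg_on_parts[of ?S v] p finite_cube by (auto simp: nonneg_on_def sum_nonneg_eq_0_iff)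
    then show False using p by (auto simp: neg_part_def)
  qed
  also have "\<dots> \<le> emd_norm d \<Delta> v"
    unfolding emd using F by (intro cINF_greatest sum_pos_part_le_cost)
  finally have pos: "0 < emd_norm d \<Delta> v" .
  then have "(INF f\<in>?F. cost d \<Delta> f) < 2 * emd_norm d \<Delta> v" unfolding emd by simp
  then obtain f where "f \<in> ?F" "cost d \<Delta> f < 2 * emd_norm d \<Delta> v"
    using cInf_lessD[of "cost d \<Delta> ` ?F"] F by auto
  then show thesis using that pos by auto
qed

text \<open>Outside two events of probability at most 1/2000 each, the grid norm is at most
  \<open>8000 * L\<close> times the earth mover norm; the factor 25 in the bound for
  \<open>L\<close> then gives 200000.\<close>

lemma prob_grid_norm_le:
  assumes sum0: "sum v (cube d (2 ^ l)) = 0"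
    and k: "card (supp_on (cube d (2 ^ l)) (pos_part v)) \<le> k" "k \<ge> 1"
  shows "0.999 \<le> measure_pmf.prob (pmf_of_set (cube d (2 ^ l)))
    {s. grid_norm d l s v
      \<le> 200000 * real d * max 1 (log 2 (real k) + log 2 (log 2 (real (2 ^ l)))) * emd_norm d (2 ^ l) v}"
proof (cases "\<forall>p\<in>cube d (2 ^ l). v p = 0")
  \<comment> \<open>The zero vector is treated apart, because Markov's inequality needs a positive
    threshold.\<close>
  case True
  let ?S = "cube d (2 ^ l)"
  let ?B = "200000 * real d * max 1 (log 2 (real k) + log 2 (log 2 (real (2 ^ l))))"
  have parts: "sum (pos_part v) ?S = sum (neg_part v) ?S" using sum_parts[of v ?S] sum0 by simp
  have "0 \<le> emd_norm d (2 ^ l) v"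
    using parts emd_balanced_nonneg[OF nonneg_on_parts parts]
    by (simp add: emd_norm_def emd_def l1_norm_nonneg_on nonneg_on_parts)
  then have "0 \<le> ?B * emd_norm d (2 ^ l) v" by (intro mult_nonneg_nonneg) auto
  moreover have "grid_norm d l s v = 0" for s
    using True by (simp add: grid_norm_eq_level_norm level_norm_def)
  ultimately have "{s. grid_norm d l s v \<le> ?B * emd_norm d (2 ^ l) v} = UNIV" by auto
  then show ?thesis by simp
next
  case False
  let ?S = "cube d (2 ^ l)"
  let ?P = "measure_pmf.prob (pmf_of_set ?S)"
  let ?E = "measure_pmf.expectation (pmf_of_set ?S)"
  let ?emd = "emd_norm d (2 ^ l) v"
  let ?M = "max 1 (log 2 (real k) + log 2 (log 2 (real (2 ^ l))))"
  obtain p where p: "p \<in> ?S" "v p \<noteq> 0" using False by blast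
  \<comment> \<open>In dimension 0 the cube is a single point, and a vector of sum 0 vanishes
    there.\<close>
  have d: "d \<ge> 1"
  proof (rule ccontr)
    assume "\<not> d \<ge> 1"
    then have "d = 0" by simp
    then have "?S = {\<lambda>_. undefined}" by (simp add: cube_def)
    then show False using sum0 p by simp
  qed
  obtain f where f: "f \<in> couplings d (2 ^ l) (pos_part v) (neg_part v)"
    and cost: "cost d (2 ^ l) f \<le> 2 * ?emd" and emd: "0 < ?emd"
    by (rule obtain_near_optimal_coupling[OF sum0 p])
  have f0: "0 \<le> f i j" if "i \<in> ?S" "j \<in> ?S" for i j using f that by (simp add: couplings_def)
  \<comment> \<open>The union bound over at most \<open>k\<close> support points and
    \<open>l + 1\<close> levels, each with probability at most \<open>2 * d / K\<close>, comes to
    1/2000.\<close>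
  define K where "K = 4000 * real k * real d * (real l + 1)"
  have "1 * 1 * 1 * 1 \<le> K" unfolding K_def using k d by (intro mult_mono) auto
  then have K: "1 \<le> K" by simp
  define L where "L = 2 + sqrt (real d) * (log 2 K + 1)"
  have L: "0 < L" using K by (auto simp: L_def intro!: add_pos_nonneg)
  have L_le: "L \<le> 25 * real d * ?M" unfolding L_def K_def by (rule log_factor_le[OF d k(2)])
  define T where "T i j = {t. t \<le> l \<and> 2 ^ t \<le> K * dist2 d i j}" for i j
  have T: "finite (T i j)" for i j by (simp add: T_def)
  define sep where "sep i j t = {s. grid_label d s t i \<noteq> grid_label d s t j}" for i j t
  \<comment> \<open>The tree cost of \<open>f\<close> truncated to the levels in
    \<open>T i j\<close>; without the truncation the expectation would involve all
    \<open>l + 1\<close> levels.\<close>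
  define X where "X s = (\<Sum>i\<in>?S. \<Sum>j\<in>?S. f i j * (\<Sum>t\<in>T i j. 2 ^ t * indicator (sep i j t) s))" for s
  have int: "integrable (measure_pmf (pmf_of_set ?S)) g" for g :: "_ \<Rightarrow> real"
    by (rule integrable_measure_pmf_finite) (simp add: finite_cube cube_nonempty)
  have "?E X = (\<Sum>i\<in>?S. \<Sum>j\<in>?S. f i j * (\<Sum>t\<in>T i j. 2 ^ t * ?P (sep i j t)))"
    unfolding X_def by (simp add: int Bochner_Integration.integral_sum)
  also have "\<dots> \<le> (\<Sum>i\<in>?S. \<Sum>j\<in>?S. f i j * (L * dist2 d i j))"
  proof (intro sum_mono mult_left_mono f0)
    fix i j
    have "(\<Sum>t\<in>T i j. 2 ^ t * ?P (sep i j t))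
        \<le> 2 * dist2 d i j + (sqrt (real d) * dist2 d i j) * (log 2 K + 1)"
      unfolding T_def using K
      by (intro weighted_levels_le) (auto simp: sep_def dist2_nonneg intro: prob_separated_le)
    then show "(\<Sum>t\<in>T i j. 2 ^ t * ?P (sep i j t)) \<le> L * dist2 d i j"
      by (simp add: L_def algebra_simps)
  qed
  also have "\<dots> = L * cost d (2 ^ l) f" by (simp add: cost_def sum_distrib_left mult_ac)
  also have "\<dots> \<le> L * (2 * ?emd)" using cost L by (intro mult_left_mono) auto
  finally have EX: "?E X \<le> 2 * L * ?emd" by simp
  have X0: "0 \<le> X s" for s
    unfolding X_def by (intro sum_nonneg mult_nonneg_nonneg f0) auto
  \<comment> \<open>The threshold is 2000 times the bound on the expectation of
    \<open>X\<close>.\<close>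
  have "?P {s. X s \<ge> 4000 * L * ?emd} \<le> ?E X / (4000 * L * ?emd)"
    using integral_Markov_inequality_measure[OF int, of "{}" X "4000 * L * ?emd"] X0 L emd by simp
  also have "\<dots> \<le> 2 * L * ?emd / (4000 * L * ?emd)"
    using EX L emd by (intro divide_right_mono) auto
  finally have markov: "?P {s. X s \<ge> 4000 * L * ?emd} \<le> 1 / 2000" using L emd by simp
  let ?A = "supp_on ?S (pos_part v)"
  have A: "finite ?A" by (simp add: supp_on_def finite_cube)
  have "?P (\<Union>i\<in>?A. \<Union>t\<in>{..l}. {s. near_boundary K d t i s})
      \<le> (\<Sum>i\<in>?A. ?P (\<Union>t\<in>{..l}. {s. near_boundary K d t i s}))"
    using A by (intro measure_UNION_le) auto
  also have "\<dots> \<le> (\<Sum>i\<in>?A. \<Sum>t\<le>l. ?P {s. near_boundary K d t i s})"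
    by (intro sum_mono measure_UNION_le) auto
  also have "\<dots> \<le> (\<Sum>i\<in>?A. \<Sum>t\<le>l. 2 * real d / K)"
    using K by (intro sum_mono prob_near_boundary_le) auto
  also have "\<dots> = real (card ?A) * ((real l + 1) * (2 * real d / K))" by (simp add: add.commute)
  also have "\<dots> \<le> real k * ((real l + 1) * (2 * real d / K))"
    using k K by (intro mult_right_mono) auto
  also have "\<dots> = 2 * (real k * real d * (real l + 1)) / (4000 * (real k * real d * (real l + 1)))"
    by (simp add: K_def mult_ac)
  also have "\<dots> = 1 / 2000"
  proof -
    have "real k * real d * (real l + 1) \<noteq> 0" using k d by (simp add: add_nonneg_eq_0_iff)
    then show ?thesis by (subst mult_divide_mult_cancel_right) auto
  qed
  finally have near: "?P (\<Union>i\<in>?A. \<Union>t\<in>{..l}. {s. near_boundary K d t i s}) \<le> 1 / 2000" .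
  let ?G = "{s. grid_norm d l s v \<le> 200000 * real d * ?M * ?emd}"
  let ?N = "{s. X s \<ge> 4000 * L * ?emd}"
  let ?U = "\<Union>i\<in>?A. \<Union>t\<in>{..l}. {s. near_boundary K d t i s}"
  have good: "s \<in> ?G" if s: "s \<notin> ?N" "s \<notin> ?U" for s
  proof -
    have pair_le: "f i j * tree_dist l (grid_label d s) i j
        \<le> f i j * (\<Sum>t\<in>T i j. 2 ^ t * indicator (sep i j t) s)" if ij: "i \<in> ?S" "j \<in> ?S" for i j
    proof (cases "i \<in> ?A")
      case False
      \<comment> \<open>Flow leaves only the support of the positive part, so it suffices to keep
        walls away from those points.\<close>
      then have "(\<Sum>j\<in>?S. f i j) = 0" using f ij by (simp add: supp_on_def couplings_def)
      then have "f i j = 0" using ij f0 finite_cube by (auto simp: sum_nonneg_eq_0_iff)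
      then show ?thesis by simp
    next
      case True
      have "t \<in> T i j" if "t \<le> l" "grid_label d s t i \<noteq> grid_label d s t j" for t
      proof (rule ccontr)
        assume "t \<notin> T i j"
        then have "near_boundary K d t i s"
          using that K by (intro separated_imp_near_boundary[OF that(2)]) (auto simp: T_def)
        then show False using s(2) True that(1) by blast
      qed
      then have "tree_dist l (grid_label d s) i j
          = (\<Sum>t\<in>T i j. 2 ^ t * of_bool (grid_label d s t i \<noteq> grid_label d s t j))"
        unfolding tree_dist_def by (intro sum.mono_neutral_right) (auto simp: T_def)
      also have "\<dots> = (\<Sum>t\<in>T i j. 2 ^ t * indicator (sep i j t) s)"
        by (intro sum.cong) (auto simp: sep_def indicator_def)
      finally show ?thesis by simp
    qed
    have "grid_norm d l s v \<le> 2 * (\<Sum>i\<in>?S. \<Sum>j\<in>?S. f i j * tree_dist l (grid_label d s) i j)"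
      unfolding grid_norm_eq_level_norm
    proof (rule level_norm_le_tree_cost[OF finite_cube f0])
      fix i assume "i \<in> ?S"
      then have "(\<Sum>j\<in>?S. f i j) = pos_part v i" "(\<Sum>j\<in>?S. f j i) = neg_part v i"
        using f by (auto simp: couplings_def)
      then show "v i = (\<Sum>j\<in>?S. f i j) - (\<Sum>j\<in>?S. f j i)" by (simp add: neg_part_def)
    qed
    also have "\<dots> \<le> 2 * X s"
      unfolding X_def using sum_mono[OF sum_mono[OF pair_le]] by simp
    also have "\<dots> \<le> 8000 * L * ?emd" using s(1) by simp
    also have "\<dots> \<le> 8000 * (25 * real d * ?M) * ?emd"
      using L_le emd by (intro mult_right_mono mult_left_mono) auto
    finally show ?thesis by simp
  qed
  have "1 = ?P UNIV" by simp
  also have "\<dots> \<le> ?P (?G \<union> (?N \<union> ?U))"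
    using good by (intro measure_pmf.finite_measure_mono) auto
  also have "\<dots> \<le> ?P ?G + ?P (?N \<union> ?U)" by (rule measure_Un_le) auto
  also have "?P (?N \<union> ?U) \<le> ?P ?N + ?P ?U" by (rule measure_Un_le) auto
  finally show ?thesis using markov near by simp
qed

text \<open>For unequal masses the bound carries the additive penalty for unmatched mass, in view of
  \<open>unbalanced_bound_fails\<close>. The \<open>max 1\<close> keeps the logarithmic factor
  positive where both logarithms vanish, as for \<open>k = 1\<close> and
  \<open>\<Delta> = 2\<close>.\<close>

theorem theorem2p9:
  "(\<exists>C>0. \<forall>(d::nat) (l::nat) (\<Delta>::nat) (\<mu> :: (nat \<Rightarrow> int) \<Rightarrow> real) \<nu> s.
      \<Delta> = 2 ^ l \<longrightarrow> nonneg_on (cube d \<Delta>) \<mu> \<longrightarrow> nonneg_on (cube d \<Delta>) \<nu> \<longrightarrow> s \<in> lattice d \<longrightarrow>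
        (sum \<mu> (cube d \<Delta>) = sum \<nu> (cube d \<Delta>) \<longrightarrow>
          emd_norm d \<Delta> (\<mu> - \<nu>) \<le> C * sqrt (real d) * grid_norm d l s (\<mu> - \<nu>))
        \<and> emd_norm d \<Delta> (\<mu> - \<nu>)
            \<le> C * sqrt (real d) * grid_norm d l s (\<mu> - \<nu>)
              + real d * real \<Delta> * \<bar>sum \<mu> (cube d \<Delta>) - sum \<nu> (cube d \<Delta>)\<bar>)
   \<and> (\<exists>C>0. \<forall>(d::nat) (l::nat) (\<Delta>::nat) (k::nat) (\<mu> :: (nat \<Rightarrow> int) \<Rightarrow> real) \<nu>.
      \<Delta> = 2 ^ l \<longrightarrow> prob_on (cube d \<Delta>) \<mu> \<longrightarrow> prob_on (cube d \<Delta>) \<nu> \<longrightarrow>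
      card (supp_on (cube d \<Delta>) \<mu>) \<le> k \<longrightarrow>
        measure_pmf.prob (pmf_of_set (cube d \<Delta>))
          {s. grid_norm d l s (\<mu> - \<nu>)
                \<le> C * real d * max 1 (log 2 (real k) + log 2 (log 2 (real \<Delta>)))
                    * emd_norm d \<Delta> (\<mu> - \<nu>)} \<ge> 0.999)"
proof (rule conjI)
  have upper: "emd_norm d (2 ^ l) (\<mu> - \<nu>) \<le> sqrt (real d) * grid_norm d l s (\<mu> - \<nu>)
      + real d * real (2 ^ l) * \<bar>sum \<mu> (cube d (2 ^ l)) - sum \<nu> (cube d (2 ^ l))\<bar>" for d l \<mu> \<nu> s
    using emd_norm_le_grid_norm[of d l "\<mu> - \<nu>" s] by (simp add: sum_subtractf)
  show "\<exists>C>0. \<forall>(d::nat) (l::nat) (\<Delta>::nat) (\<mu> :: (nat \<Rightarrow> int) \<Rightarrow> real) \<nu> s.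
      \<Delta> = 2 ^ l \<longrightarrow> nonneg_on (cube d \<Delta>) \<mu> \<longrightarrow> nonneg_on (cube d \<Delta>) \<nu> \<longrightarrow> s \<in> lattice d \<longrightarrow>
        (sum \<mu> (cube d \<Delta>) = sum \<nu> (cube d \<Delta>) \<longrightarrow>
          emd_norm d \<Delta> (\<mu> - \<nu>) \<le> C * sqrt (real d) * grid_norm d l s (\<mu> - \<nu>))
        \<and> emd_norm d \<Delta> (\<mu> - \<nu>)
            \<le> C * sqrt (real d) * grid_norm d l s (\<mu> - \<nu>)
              + real d * real \<Delta> * \<bar>sum \<mu> (cube d \<Delta>) - sum \<nu> (cube d \<Delta>)\<bar>"
  proof (intro exI[of _ 1] conjI allI impI)
    fix d l \<Delta> \<mu> \<nu> s assume \<Delta>: "\<Delta> = (2::nat) ^ l"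
    show "emd_norm d \<Delta> (\<mu> - \<nu>) \<le> 1 * sqrt (real d) * grid_norm d l s (\<mu> - \<nu>)
        + real d * real \<Delta> * \<bar>sum \<mu> (cube d \<Delta>) - sum \<nu> (cube d \<Delta>)\<bar>"
      using upper[of d l \<mu> \<nu> s] by (simp add: \<Delta>)
    show "emd_norm d \<Delta> (\<mu> - \<nu>) \<le> 1 * sqrt (real d) * grid_norm d l s (\<mu> - \<nu>)"
      if "sum \<mu> (cube d \<Delta>) = sum \<nu> (cube d \<Delta>)"
      using upper[of d l \<mu> \<nu> s] that by (simp add: \<Delta>)
  qed simp
  show "\<exists>C>0. \<forall>(d::nat) (l::nat) (\<Delta>::nat) (k::nat) (\<mu> :: (nat \<Rightarrow> int) \<Rightarrow> real) \<nu>.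
      \<Delta> = 2 ^ l \<longrightarrow> prob_on (cube d \<Delta>) \<mu> \<longrightarrow> prob_on (cube d \<Delta>) \<nu> \<longrightarrow>
      card (supp_on (cube d \<Delta>) \<mu>) \<le> k \<longrightarrow>
        measure_pmf.prob (pmf_of_set (cube d \<Delta>))
          {s. grid_norm d l s (\<mu> - \<nu>)
                \<le> C * real d * max 1 (log 2 (real k) + log 2 (log 2 (real \<Delta>)))
                    * emd_norm d \<Delta> (\<mu> - \<nu>)} \<ge> 0.999"
  proof (rule exI[of _ 200000], intro conjI allI impI)
    fix d l \<Delta> k :: nat and \<mu> \<nu> :: "(nat \<Rightarrow> int) \<Rightarrow> real"
    assume \<Delta>: "\<Delta> = 2 ^ l" and \<mu>: "prob_on (cube d \<Delta>) \<mu>" and \<nu>: "prob_on (cube d \<Delta>) \<nu>"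
      and k: "card (supp_on (cube d \<Delta>) \<mu>) \<le> k"
    have fin: "finite (supp_on (cube d \<Delta>) \<mu>)" by (simp add: supp_on_def finite_cube)
    have "supp_on (cube d \<Delta>) \<mu> \<noteq> {}"
    proof
      assume "supp_on (cube d \<Delta>) \<mu> = {}"
      then have "sum \<mu> (cube d \<Delta>) = 0" by (intro sum.neutral) (auto simp: supp_on_def)
      then show False using \<mu> by (simp add: prob_on_def)
    qed
    then have "1 \<le> card (supp_on (cube d \<Delta>) \<mu>)" using fin by (simp add: Suc_le_eq card_gt_0_iff)
    then have k1: "1 \<le> k" using k by simp
    \<comment> \<open>Where \<open>\<mu>\<close> vanishes, the difference is at most 0 because
      \<open>\<nu>\<close> is nonnegative.\<close>
    have "supp_on (cube d \<Delta>) (pos_part (\<mu> - \<nu>)) \<subseteq> supp_on (cube d \<Delta>) \<mu>"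
      using \<nu> by (auto simp: supp_on_def pos_part_def prob_on_def nonneg_on_def)
    then have "card (supp_on (cube d \<Delta>) (pos_part (\<mu> - \<nu>))) \<le> k"
      using card_mono[OF fin] k le_trans by blast
    moreover have "sum (\<mu> - \<nu>) (cube d \<Delta>) = 0"
      using \<mu> \<nu> by (simp add: prob_on_def sum_subtractf)
    ultimately show "measure_pmf.prob (pmf_of_set (cube d \<Delta>))
          {s. grid_norm d l s (\<mu> - \<nu>)
                \<le> 200000 * real d * max 1 (log 2 (real k) + log 2 (log 2 (real \<Delta>)))
                    * emd_norm d \<Delta> (\<mu> - \<nu>)} \<ge> 0.999"
      unfolding \<Delta> using k1 by (intro prob_grid_norm_le)
  qed simp
qed

end
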